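(* Let $\Omega\subset\mathbb{R}^2$ be a bounded simply connected domain with smooth boundary $\partial\Omega$ and let $\Gamma$ be a non-empty open subset of $\partial\Omega$. Suppose that $u$ satisfies $$\Delta u(x)=0\quad (x\in\Omega),\qquad u(x)=f(x)\quad (x\in\Gamma),\qquad \partial_\nu u(x)=g(x)\quad (x\in\Gamma),$$ and that $\|u\|_{C^1(\overline{\Omega})}\le M$, where $M>0$ is an arbitrarily given constant. Then $$|u(x)|\le C(M,\Omega)\,\varepsilon^{\tau(x)}\qquad\text{for all } x\in\Omega,$$ where $C(M,\Omega)>0$ is a constant depending only on $M$ and $\Omega$, $$\varepsilon=\|f\|_{W^{1,\infty}(\Gamma)}+\|g\|_{L^\infty(\Gamma)},$$ and $\tau$ is the harmonic measure for $\Omega$ and $\Gamma$.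
   Context: $\nu$ denotes the outer normal vector to $\partial\Omega$ and $\partial_\nu u=\nabla u\cdot\nu$. Identify $\mathbb{R}^2$ with $\mathbb{C}$. For a simply connected domain $U$ with piecewise regular boundary and a nonempty open subset $\ell$ of $\partial U$, the harmonic measure for $U$ and $\ell$ is the (bounded) function $\mu$ with $\Delta\mu=0$ in $U$, $\mu=0$ on $\partial U\setminus\overline{\ell}$, and $\mu=1$ on $\overline{\ell}$ (boundary values at the end points of $\ell$, where the data jump, play no role). *)

theory Defs
  imports "HOL-Analysis.Analysis" "HOL-Probability.Essential_Supremum"
begin

text \<open>The plane is identified with the type \<^typ>\<open>complex\<close>, viewed as a real inner product
  space; gradients are therefore complex-valued.\<close>

section \<open>Smooth domains\<close>

definition smooth_curve :: "(real \<Rightarrow> complex) \<Rightarrow> bool" where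
  "smooth_curve \<gamma> \<longleftrightarrow>
     (\<exists>D. D 0 = \<gamma> \<and> (\<forall>k t. (D k has_vector_derivative D (Suc k) t) (at t)))"

definition smooth_closed_parametrization :: "(real \<Rightarrow> complex) \<Rightarrow> complex set \<Rightarrow> bool" where
  "smooth_closed_parametrization \<gamma> S \<longleftrightarrow>
     smooth_curve \<gamma> \<and> (\<forall>t. vector_derivative \<gamma> (at t) \<noteq> 0) \<and>
     (\<forall>t. \<gamma> (t + 1) = \<gamma> t) \<and> inj_on \<gamma> {0..<1} \<and> \<gamma> ` {0..<1} = S"

text \<open>The boundary of a bounded simply connected plane domain is connected, so that it is smooth
  iff it is a single regular simple closed curve of class \<open>C\<^sup>\<infinity>\<close>.\<close>

definition smooth_simply_connected_domain :: "complex set \<Rightarrow> bool" where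
  "smooth_simply_connected_domain \<Omega> \<longleftrightarrow>
     open \<Omega> \<and> \<Omega> \<noteq> {} \<and> bounded \<Omega> \<and> connected \<Omega> \<and> simply_connected \<Omega> \<and>
     (\<exists>\<gamma>. smooth_closed_parametrization \<gamma> (frontier \<Omega>))"

text \<open>The parametrization chosen here only serves to define arc length and the derivative with
  respect to arc length; neither depends on the choice, up to the orientation of the latter.\<close>

definition boundary_param :: "complex set \<Rightarrow> real \<Rightarrow> complex" where
  "boundary_param \<Omega> = (SOME \<gamma>. smooth_closed_parametrization \<gamma> (frontier \<Omega>))"

definition boundary_speed :: "complex set \<Rightarrow> real \<Rightarrow> real" where
  "boundary_speed \<Omega> t = norm (vector_derivative (boundary_param \<Omega>) (at t))"

definition arclength_measure :: "complex set \<Rightarrow> complex measure" where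
  "arclength_measure \<Omega> =
     distr (density (restrict_space lborel {0..<1}) (\<lambda>t. ennreal (boundary_speed \<Omega> t)))
       borel (boundary_param \<Omega>)"

text \<open>The first limit says that \<open>\<nu>\<close> is orthogonal to the tangent line of the boundary at \<open>x\<close>.\<close>

definition is_outer_unit_normal :: "complex set \<Rightarrow> complex \<Rightarrow> complex \<Rightarrow> bool" where
  "is_outer_unit_normal \<Omega> x \<nu> \<longleftrightarrow>
     norm \<nu> = 1 \<and>
     ((\<lambda>y. \<nu> \<bullet> (y - x) / norm (y - x)) \<longlongrightarrow> 0) (at x within frontier \<Omega>) \<and>
     (\<exists>d>0. \<forall>s. 0 < s \<and> s < d \<longrightarrow> x - s *\<^sub>R \<nu> \<in> \<Omega> \<and> x + s *\<^sub>R \<nu> \<notin> closure \<Omega>)"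

section \<open>Harmonic functions and harmonic measure\<close>

text \<open>Here \<open>H z\<close> is the Hessian of \<open>u\<close> at \<open>z\<close>, as a linear map; the Laplacian is its trace.\<close>

definition harmonic_on :: "('a::euclidean_space \<Rightarrow> real) \<Rightarrow> 'a set \<Rightarrow> bool" where
  "harmonic_on u S \<longleftrightarrow>
     (\<exists>G H. (\<forall>z\<in>S. GDERIV u z :> G z) \<and>
            (\<forall>z\<in>S. (G has_derivative H z) (at z)) \<and>
            (\<forall>b\<in>Basis. continuous_on S (\<lambda>z. H z b)) \<and>
            (\<forall>z\<in>S. (\<Sum>b\<in>Basis. H z b \<bullet> b) = 0))"

text \<open>The boundary data are \<open>1\<close> on \<open>closure l\<close> and \<open>0\<close> on the rest of the boundary; no limit is
  required at the points where these data jump, that is, at the points of \<open>closure l\<close> which are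
  limits of points of \<open>frontier U - closure l\<close>. If these are finitely many (\<open>l\<close> being a finite
  union of arcs), the bound \<open>0 \<le> \<mu> \<le> 1\<close> is, by the maximum principle, the same as boundedness
  of \<open>\<mu>\<close>, and \<open>\<mu>\<close> is unique. For a general relatively open \<open>l\<close> the set of jumps may have positive
  length, and then boundedness alone would not even keep \<open>\<mu>\<close> between the values of its data.\<close>

definition is_harmonic_measure :: "complex set \<Rightarrow> complex set \<Rightarrow> (complex \<Rightarrow> real) \<Rightarrow> bool" where
  "is_harmonic_measure U l \<mu> \<longleftrightarrow>
     harmonic_on \<mu> U \<and> (\<forall>z\<in>U. 0 \<le> \<mu> z \<and> \<mu> z \<le> 1) \<and>
     (\<forall>z\<in>frontier U - closure l. (\<mu> \<longlongrightarrow> 0) (at z within U)) \<and>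
     (\<forall>z\<in>closure l - closure (frontier U - closure l). (\<mu> \<longlongrightarrow> 1) (at z within U))"

section \<open>Norms\<close>

text \<open>\<open>u\<close> is of class \<open>C\<^sup>1\<close> up to the boundary: \<open>G\<close> is the gradient in \<open>\<Omega>\<close> and its continuous
  extension to \<open>closure \<Omega>\<close>. Boundary values of the gradient are those of this extension.\<close>

definition C1_closure_with_gradient ::
    "complex set \<Rightarrow> (complex \<Rightarrow> real) \<Rightarrow> (complex \<Rightarrow> complex) \<Rightarrow> bool" where
  "C1_closure_with_gradient \<Omega> u G \<longleftrightarrow>
     continuous_on (closure \<Omega>) u \<and> continuous_on (closure \<Omega>) G \<and>
     (\<forall>x\<in>\<Omega>. GDERIV u x :> G x)"

definition C1_norm :: "complex set \<Rightarrow> (complex \<Rightarrow> real) \<Rightarrow> (complex \<Rightarrow> complex) \<Rightarrow> real" where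
  "C1_norm \<Omega> u G = (SUP x\<in>closure \<Omega>. \<bar>u x\<bar>) + (SUP x\<in>closure \<Omega>. norm (G x))"

definition Linf_enorm :: "complex set \<Rightarrow> complex set \<Rightarrow> (complex \<Rightarrow> real) \<Rightarrow> ereal" where
  "Linf_enorm \<Omega> \<Gamma> g = esssup (restrict_space (arclength_measure \<Omega>) \<Gamma>) (\<lambda>x. ereal \<bar>g x\<bar>)"

definition Linf_norm :: "complex set \<Rightarrow> complex set \<Rightarrow> (complex \<Rightarrow> real) \<Rightarrow> real" where
  "Linf_norm \<Omega> \<Gamma> g = real_of_ereal (Linf_enorm \<Omega> \<Gamma> g)"

definition tangential_derivative ::
    "complex set \<Rightarrow> (complex \<Rightarrow> real) \<Rightarrow> (complex \<Rightarrow> real) \<Rightarrow> bool" where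
  "tangential_derivative \<Omega> \<phi> \<psi> \<longleftrightarrow>
     (\<forall>t. ((\<lambda>t. \<phi> (boundary_param \<Omega> t)) has_real_derivative
            \<psi> (boundary_param \<Omega> t) * boundary_speed \<Omega> t) (at t))"

text \<open>Weak derivative of \<open>f\<close> with respect to arc length, tested against \<open>C\<^sup>1\<close> functions \<open>\<phi>\<close> with
  support in \<open>\<Gamma>\<close> (compact, since the boundary is).\<close>

definition weak_tangential_derivative ::
    "complex set \<Rightarrow> complex set \<Rightarrow> (complex \<Rightarrow> real) \<Rightarrow> (complex \<Rightarrow> real) \<Rightarrow> bool" where
  "weak_tangential_derivative \<Omega> \<Gamma> f w \<longleftrightarrow>
     w \<in> borel_measurable (restrict_space (arclength_measure \<Omega>) \<Gamma>) \<and>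
     Linf_enorm \<Omega> \<Gamma> w < \<infinity> \<and>
     (\<forall>\<phi> \<psi>. tangential_derivative \<Omega> \<phi> \<psi> \<and> continuous_on (frontier \<Omega>) \<psi> \<and>
            closure {x \<in> frontier \<Omega>. \<phi> x \<noteq> 0} \<subseteq> \<Gamma> \<longrightarrow>
        (LINT x:\<Gamma>|arclength_measure \<Omega>. f x * \<psi> x) =
          - (LINT x:\<Gamma>|arclength_measure \<Omega>. w x * \<phi> x))"

text \<open>Meaningful for \<open>f\<close> having a bounded weak derivative, which is unique almost everywhere; this
  is the case for traces of functions that are \<open>C\<^sup>1\<close> up to the boundary.\<close>

definition W1inf_norm :: "complex set \<Rightarrow> complex set \<Rightarrow> (complex \<Rightarrow> real) \<Rightarrow> real" where
  "W1inf_norm \<Omega> \<Gamma> f =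
     Linf_norm \<Omega> \<Gamma> f + Linf_norm \<Omega> \<Gamma> (SOME w. weak_tangential_derivative \<Omega> \<Gamma> f w)"

end

theory Submission
  imports Defs "HOL-Complex_Analysis.Conformal_Mappings"
begin

text \<open>Let \<open>0 < \<epsilon> < 1\<close> and \<open>N = ln (1 / \<epsilon>)\<close>, so that \<open>\<epsilon> powr \<tau> = exp (- N * \<tau>)\<close>. On \<open>closure \<Gamma>\<close>
  both \<open>u\<close> and its gradient \<open>G\<close> are at most \<open>\<epsilon>\<close>: the tangential part of \<open>G\<close> is the derivative of
  \<open>f\<close>, the normal part is \<open>g\<close>. On the rest of the boundary they are at most \<open>M\<close>, and \<open>\<tau>\<close> tends to
  \<open>0\<close>. As \<open>\<tau> \<le> 1\<close>, both are therefore bounded by \<open>max M 1 * exp (- N * \<tau>)\<close> in the limit at every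
  boundary point, including those where \<open>\<tau>\<close> has no limit. It remains to carry this bound into \<open>\<Omega>\<close>.

  For \<open>G\<close> this is the two constants theorem: \<open>cnj G\<close> is holomorphic, hence \<open>ln \<bar>G\<bar>\<close> is harmonic where
  \<open>G\<close> does not vanish, and the maximum principle applies to \<open>ln \<bar>G\<bar> + N * \<tau>\<close>
  (\<open>gradient_upper_bound\<close>).

  The passage from \<open>G\<close> to \<open>u\<close> is the main point. If \<open>\<Gamma>\<close> is not connected, the harmonic conjugate of
  \<open>u\<close> differs from a constant by little on each component of \<open>\<Gamma>\<close>, but these constants
  need not be close to each other, so that the two constants theorem cannot be applied to a holomorphic
  function with real part \<open>u\<close>. Nor does it help to integrate \<open>G\<close> along a curve from \<open>\<Gamma>\<close> on which
  \<open>\<tau>\<close> does not fall below its value at the end: the length of such a curve is not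
  bounded in terms of \<open>\<Omega>\<close> in any evident way. Instead, the maximum principle is applied directly
  to \<open>u\<close>. For harmonic \<open>u > 0\<close> the Laplacian of \<open>ln u\<close> is \<open>- (\<bar>G\<bar> / u)\<^sup>2\<close>. Let \<open>K * exp (- N * \<tau>)\<close> be the bound obtained for \<open>\<bar>G\<bar>\<close>. Where
  \<open>u > K * exp (- N * \<tau>)\<close>, this Laplacian exceeds \<open>-1\<close>, and \<open>ln u + N * \<tau> + \<bar>z\<bar>\<^sup>2\<close> is strictly
  subharmonic, hence without maximum. So \<open>u\<close> exceeds
  \<open>K * exp (- N * \<tau>)\<close> at most by a factor \<open>exp (R\<^sup>2)\<close>, where \<open>\<bar>z\<bar> \<le> R\<close> on \<open>\<Omega>\<close>. Both
  bounds are instances of \<open>exponential_comparison\<close>, and the constant is \<open>max M 1 * exp (2 * R\<^sup>2)\<close>.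

  If \<open>\<epsilon> \<ge> 1\<close>, the bound \<open>\<bar>u\<bar> \<le> M\<close> suffices. If \<open>\<epsilon> = 0\<close>, the estimate for all positive \<open>\<epsilon>\<close> shows that \<open>u\<close>
  vanishes where \<open>\<tau> > 0\<close>; this is a nonempty open set, because \<open>\<tau>\<close> tends to \<open>1\<close> at the points of
  \<open>\<Gamma>\<close>, and \<open>u\<close> vanishes identically by analytic continuation of \<open>cnj G\<close> (\<open>zero_cauchy_data\<close>).

  That \<open>\<epsilon>\<close> bounds \<open>u\<close> and \<open>G\<close> pointwise on \<open>\<Gamma>\<close> (\<open>cauchy_data_bound\<close>) rests on three facts: along the
  boundary, \<open>u\<close> has the derivative which the boundary values of \<open>G\<close> prescribe
  (\<open>trace_has_derivative\<close>); nonempty relatively open subsets of the boundary have positive length,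
  so that essential suprema of continuous functions are suprema (\<open>arclength_pos\<close>); and the essential
  supremum of any weak tangential derivative of \<open>f\<close> dominates the classical one
  (\<open>weak_tangential_derivative_ge\<close>).\<close>

section \<open>The Laplacian at a point\<close>

text \<open>The gradient is required near \<open>z\<close>, the second derivative at \<open>z\<close> only; the second derivative test uses
  no more.\<close>

definition has_laplacian :: "(complex \<Rightarrow> real) \<Rightarrow> complex \<Rightarrow> real \<Rightarrow> bool" where
  "has_laplacian f z l \<longleftrightarrow>
     (\<exists>G H. (\<forall>\<^sub>F w in nhds z. GDERIV f w :> G w) \<and> (G has_derivative H) (at z) \<and>
            (\<Sum>b\<in>Basis. H b \<bullet> b) = l)"

lemma has_laplacianI:
  assumes "\<forall>\<^sub>F w in nhds z. GDERIV f w :> G w" and "(G has_derivative H) (at z)"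
    and "(\<Sum>b\<in>Basis. H b \<bullet> b) = l"
  shows "has_laplacian f z l"
  using assms unfolding has_laplacian_def by blast

lemma has_laplacian_add:
  assumes "has_laplacian f z k" and "has_laplacian g z l"
  shows "has_laplacian (\<lambda>w. f w + g w) z (k + l)"
proof -
  from assms obtain F f2 G g2 where
    F: "\<forall>\<^sub>F w in nhds z. GDERIV f w :> F w" "(F has_derivative f2) (at z)"
       "(\<Sum>b\<in>Basis. f2 b \<bullet> b) = k" and
    G: "\<forall>\<^sub>F w in nhds z. GDERIV g w :> G w" "(G has_derivative g2) (at z)"
       "(\<Sum>b\<in>Basis. g2 b \<bullet> b) = l"
    unfolding has_laplacian_def by blast
  have "\<forall>\<^sub>F w in nhds z. GDERIV (\<lambda>w. f w + g w) w :> F w + G w"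
    using F(1) G(1) by eventually_elim (rule GDERIV_add)
  moreover have "((\<lambda>w. F w + G w) has_derivative (\<lambda>v. f2 v + g2 v)) (at z)"
    using F(2) G(2) by (rule has_derivative_add)
  moreover have "(\<Sum>b\<in>Basis. (f2 b + g2 b) \<bullet> b) = k + l"
    using F(3) G(3) by (simp add: inner_add_left sum.distrib)
  ultimately show ?thesis by (rule has_laplacianI)
qed

lemma has_laplacian_cmult:
  assumes "has_laplacian f z l"
  shows "has_laplacian (\<lambda>w. c * f w) z (c * l)"
proof -
  from assms obtain F f2 where
    F: "\<forall>\<^sub>F w in nhds z. GDERIV f w :> F w" "(F has_derivative f2) (at z)"
       "(\<Sum>b\<in>Basis. f2 b \<bullet> b) = l"
    unfolding has_laplacian_def by blast
  have "\<forall>\<^sub>F w in nhds z. GDERIV (\<lambda>w. c * f w) w :> c *\<^sub>R F w"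
    using F(1)
  proof eventually_elim
    case (elim w)
    show ?case using GDERIV_mult[OF GDERIV_const elim, of c] by simp
  qed
  moreover have "((\<lambda>w. c *\<^sub>R F w) has_derivative (\<lambda>v. c *\<^sub>R f2 v)) (at z)"
    using F(2) by (rule has_derivative_scaleR_right)
  moreover have "(\<Sum>b\<in>Basis. (c *\<^sub>R f2 b) \<bullet> b) = c * l"
    using F(3) by (simp flip: sum_distrib_left)
  ultimately show ?thesis by (rule has_laplacianI)
qed

lemma has_laplacian_norm_squared: "has_laplacian (\<lambda>w. (norm w)\<^sup>2) z 4"
proof -
  have "GDERIV (\<lambda>w::complex. (norm w)\<^sup>2) w :> 2 *\<^sub>R w" for w
    unfolding gderiv_def power2_norm_eq_inner
    by (auto intro!: derivative_eq_intros simp: inner_commute)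
  moreover have "((\<lambda>w::complex. 2 *\<^sub>R w) has_derivative (\<lambda>v. 2 *\<^sub>R v)) (at z)"
    by (auto intro!: derivative_eq_intros)
  moreover have "(\<Sum>b\<in>Basis. (2 *\<^sub>R b) \<bullet> (b::complex)) = 4"
    by (simp add: Basis_complex_def)
  ultimately show ?thesis unfolding has_laplacian_def
    by (intro exI[of _ "\<lambda>w. 2 *\<^sub>R w"] exI[of _ "\<lambda>v. 2 *\<^sub>R v"]) auto
qed

lemma has_laplacian_cong:
  assumes "has_laplacian f z l" "\<forall>\<^sub>F w in nhds z. f w = g w"
  shows "has_laplacian g z l"
proof -
  from assms obtain F f2 where
    F: "\<forall>\<^sub>F w in nhds z. GDERIV f w :> F w" "(F has_derivative f2) (at z)"
       "(\<Sum>b\<in>Basis. f2 b \<bullet> b) = l"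
    unfolding has_laplacian_def by blast
  have "\<forall>\<^sub>F w in nhds z. \<forall>\<^sub>F y in nhds w. f y = g y"
    using assms(2) by (simp add: eventually_eventually)
  with F(1) have "\<forall>\<^sub>F w in nhds z. GDERIV g w :> F w"
  proof eventually_elim
    case (elim w)
    have "f w = g w" using elim(2) by (rule eventually_nhds_x_imp_x)
    moreover have "\<forall>\<^sub>F y in at w. f y = g y"
      using elim(2) by (simp add: eventually_at_filter eventually_mono)
    ultimately show ?case
      using elim(1) unfolding gderiv_def
      by (metis has_derivative_transform_eventually UNIV_I)
  qed
  with F show ?thesis unfolding has_laplacian_def by blast
qed

lemma has_laplacian_Re_holomorphic:
  assumes "open S" "z \<in> S" "f holomorphic_on S"
  shows "has_laplacian (\<lambda>w. Re (f w)) z 0"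
proof -
  have "GDERIV (\<lambda>w. Re (f w)) w :> cnj (deriv f w)" if "w \<in> S" for w
  proof -
    have "(f has_derivative (*) (deriv f w)) (at w)"
      using holomorphic_derivI[OF assms(3,1) that] by (simp add: has_field_derivative_def)
    then have "((\<lambda>w. Re (f w)) has_derivative (\<lambda>v. Re (deriv f w * v))) (at w)"
      by (rule has_derivative_Re)
    moreover have "(\<lambda>v. Re (deriv f w * v)) = (\<lambda>v. v \<bullet> cnj (deriv f w))"
      by (auto simp: inner_complex_def)
    ultimately show ?thesis by (simp add: gderiv_def)
  qed
  then have "\<forall>\<^sub>F w in nhds z. GDERIV (\<lambda>w. Re (f w)) w :> cnj (deriv f w)"
    using eventually_nhds_in_open[OF assms(1,2)] by (rule eventually_mono[rotated])
  moreover have "((\<lambda>w. cnj (deriv f w)) has_derivative (\<lambda>v. cnj (deriv (deriv f) z * v))) (at z)"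
  proof -
    have "deriv f holomorphic_on S" using assms by (simp add: holomorphic_deriv)
    then have "(deriv f has_derivative (*) (deriv (deriv f) z)) (at z)"
      using holomorphic_derivI[OF _ assms(1,2)] by (simp add: has_field_derivative_def)
    then show ?thesis by (rule has_derivative_cnj)
  qed
  moreover have "(\<Sum>b\<in>Basis. cnj (deriv (deriv f) z * b) \<bullet> b) = 0"
    by (simp add: Basis_complex_def inner_complex_def)
  ultimately show ?thesis by (rule has_laplacianI)
qed

text \<open>Near a zero-free point, \<open>ln \<bar>f\<bar>\<close> is the real part of a branch of \<open>Ln f\<close>.\<close>

text \<open>Near \<open>z\<close> there is a holomorphic logarithm of \<open>f\<close>, and \<open>ln \<bar>f\<bar>\<close> is its real part.\<close>

lemma has_laplacian_ln_norm_holomorphic: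
  assumes "open S" "z \<in> S" "f holomorphic_on S" "f z \<noteq> 0"
  shows "has_laplacian (\<lambda>w. ln (norm (f w))) z 0"
proof -
  \<comment> \<open>After division by \<open>f z\<close> the values near \<open>z\<close> lie in the right half plane, where \<open>Ln\<close> is holomorphic.\<close>
  define g where "g w = f w / f z" for w
  define T where "T = {w \<in> S. Re (g w) > 0}"
  have hg: "g holomorphic_on S"
    unfolding g_def using assms by (intro holomorphic_intros) auto
  have "open T"
  proof -
    have "open (S \<inter> g -` {w. Re w > 0})"
      using assms(1) holomorphic_on_imp_continuous_on[OF hg] open_halfspace_Re_gt[of 0]
      by (intro continuous_open_preimage) auto
    then show ?thesis by (simp add: T_def vimage_def Int_def)
  qed
  moreover have "z \<in> T" using assms by (simp add: T_def g_def)
  moreover have "(\<lambda>w. Ln (g w) + of_real (ln (norm (f z)))) holomorphic_on T"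
    unfolding T_def
    by (intro holomorphic_intros holomorphic_on_subset[OF hg]) (auto simp: complex_nonpos_Reals_iff)
  ultimately have L: "has_laplacian (\<lambda>w. Re (Ln (g w) + of_real (ln (norm (f z))))) z 0"
    by (rule has_laplacian_Re_holomorphic)
  have "\<forall>\<^sub>F w in nhds z. w \<in> T" using \<open>open T\<close> \<open>z \<in> T\<close> by (rule eventually_nhds_in_open)
  then have "\<forall>\<^sub>F w in nhds z. Re (Ln (g w) + of_real (ln (norm (f z)))) = ln (norm (f w))"
  proof eventually_elim
    case (elim w)
    then have "g w \<noteq> 0" by (auto simp: T_def)
    then show ?case using assms(4) by (auto simp: g_def norm_divide ln_div)
  qed
  with L show ?thesis by (rule has_laplacian_cong)
qed

text \<open>The chain rule, with \<open>ln'' = - 1 / x\<^sup>2\<close>. This is the only place where the failure of \<open>ln u\<close> to be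
  harmonic is measured; the defect \<open>(\<bar>G\<bar> / u)\<^sup>2\<close> is bounded wherever \<open>u\<close> dominates its gradient.\<close>

lemma has_laplacian_ln:
  assumes G: "\<forall>\<^sub>F w in nhds z. GDERIV u w :> G w" and H: "(G has_derivative H) (at z)"
    and tr: "(\<Sum>b\<in>Basis. H b \<bullet> b) = 0" and pos: "u z > 0"
  shows "has_laplacian (\<lambda>w. ln (u w)) z (- (norm (G z) / u z)\<^sup>2)"
proof -
  have Gz: "GDERIV u z :> G z" using G by (rule eventually_nhds_x_imp_x)
  then have uz: "(u has_derivative (\<lambda>v. v \<bullet> G z)) (at z)" by (simp add: gderiv_def)
  then have "isCont u z" by (rule has_derivative_continuous)
  then have "\<forall>\<^sub>F w in nhds z. u w > 0"
    using pos unfolding continuous_at tendsto_at_iff_tendsto_nhds by (rule order_tendstoD(1))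
  with G have "\<forall>\<^sub>F w in nhds z. GDERIV (\<lambda>w. ln (u w)) w :> (1 / u w) *\<^sub>R G w"
  proof eventually_elim
    case (elim w)
    from GDERIV_DERIV_compose[OF elim(1) DERIV_ln_divide[OF elim(2)]] show ?case .
  qed
  moreover have "((\<lambda>w. (1 / u w) *\<^sub>R G w) has_derivative
      (\<lambda>v. (1 / u z) *\<^sub>R H v + (- (v \<bullet> G z) / (u z)\<^sup>2) *\<^sub>R G z)) (at z)"
    using pos
    by (auto intro!: derivative_eq_intros uz H simp: fun_eq_iff power2_eq_square divide_simps)
  moreover have "(\<Sum>b\<in>Basis. ((1 / u z) *\<^sub>R H b + (- (b \<bullet> G z) / (u z)\<^sup>2) *\<^sub>R G z) \<bullet> b)
      = - (norm (G z) / u z)\<^sup>2"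
  proof -
    have "(\<Sum>b\<in>Basis. ((1 / u z) *\<^sub>R H b + (- (b \<bullet> G z) / (u z)\<^sup>2) *\<^sub>R G z) \<bullet> b)
       = (1 / u z) * (\<Sum>b\<in>Basis. H b \<bullet> b) - (\<Sum>b\<in>Basis. (b \<bullet> G z) * (G z \<bullet> b)) / (u z)\<^sup>2"
      by (simp add: inner_add_left inner_diff_left sum.distrib sum_distrib_left sum_divide_distrib
          sum_negf sum_subtractf)
    also have "(\<Sum>b\<in>Basis. (b \<bullet> G z) * (G z \<bullet> b)) = (norm (G z))\<^sup>2"
      by (simp add: power2_norm_eq_inner euclidean_inner[of "G z" "G z"] inner_commute)
    finally show ?thesis using tr by (simp add: power_divide)
  qed
  ultimately show ?thesis by (rule has_laplacianI)
qed

lemma harmonic_on_has_laplacian: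
  assumes "harmonic_on u S" "open S" "z \<in> S"
  shows "has_laplacian u z 0"
proof -
  from assms(1) obtain G H where "\<forall>z\<in>S. GDERIV u z :> G z" "\<forall>z\<in>S. (G has_derivative H z) (at z)"
    "\<forall>z\<in>S. (\<Sum>b\<in>Basis. H z b \<bullet> b) = 0"
    unfolding harmonic_on_def by blast
  moreover then have "\<forall>\<^sub>F w in nhds z. GDERIV u w :> G w"
    using eventually_nhds_in_open[OF assms(2,3)] by (auto elim: eventually_mono)
  ultimately show ?thesis using assms(3) unfolding has_laplacian_def by blast
qed

text \<open>At a maximum of \<open>f\<close> the second derivative is nonpositive along each coordinate line, and the
  Laplacian is the sum of these.\<close>

lemma laplacian_nonpos_at_local_max:
  assumes lap: "has_laplacian f z l" and max: "\<forall>\<^sub>F w in nhds z. f w \<le> f z"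
  shows "l \<le> 0"
proof -
  from lap obtain G H where
    G: "\<forall>\<^sub>F w in nhds z. GDERIV f w :> G w" and H: "(G has_derivative H) (at z)"
       and l: "(\<Sum>b\<in>Basis. H b \<bullet> b) = l"
    unfolding has_laplacian_def by blast
  have "H b \<bullet> b \<le> 0" for b
  proof (rule ccontr)
    assume "\<not> ?thesis"
    then have pos: "H b \<bullet> b > 0" by simp
    define \<phi> where "\<phi> t = f (z + t *\<^sub>R b)" for t :: real
    define g where "g t = G (z + t *\<^sub>R b) \<bullet> b" for t :: real
    have line: "((\<lambda>t. z + t *\<^sub>R b) \<longlongrightarrow> z) (nhds 0)"
    proof -
      have "((\<lambda>t. z + t *\<^sub>R b) \<longlongrightarrow> z + 0 *\<^sub>R b) (nhds 0)"
        by (intro tendsto_add tendsto_const tendsto_scaleR filterlim_ident)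
      then show ?thesis by simp
    qed
    have line_deriv: "((\<lambda>t. z + t *\<^sub>R b) has_derivative (\<lambda>s. s *\<^sub>R b)) (at t)" for t
      by (auto intro!: derivative_eq_intros)
    have phi: "\<forall>\<^sub>F t in nhds 0. DERIV \<phi> t :> g t"
      using eventually_compose_filterlim[OF G line]
    proof eventually_elim
      case (elim t)
      have "((\<lambda>t. f (z + t *\<^sub>R b)) has_derivative (\<lambda>s. (s *\<^sub>R b) \<bullet> G (z + t *\<^sub>R b))) (at t)"
        using line_deriv elim unfolding gderiv_def by (rule has_derivative_compose)
      then show ?case unfolding has_field_derivative_def \<phi>_def g_def
        by (simp add: inner_commute mult.commute[of _ "_ \<bullet> _"])
    qed
    have g: "DERIV g 0 :> H b \<bullet> b"
    proof -
      have "((\<lambda>t. G (z + t *\<^sub>R b)) has_derivative (\<lambda>s. H (s *\<^sub>R b))) (at 0)"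
        using line_deriv[of 0] H by (intro has_derivative_compose[OF line_deriv]) simp
      then have "((\<lambda>t. G (z + t *\<^sub>R b) \<bullet> b) has_derivative (\<lambda>s. H (s *\<^sub>R b) \<bullet> b)) (at 0)"
        by (rule has_derivative_inner_left)
      moreover have "H (s *\<^sub>R b) = s *\<^sub>R H b" for s
        using H by (simp add: has_derivative_def linear_simps)
      ultimately show ?thesis
        unfolding has_field_derivative_def g_def by (simp add: mult.commute[of _ "_ \<bullet> _"])
    qed
    have "\<forall>\<^sub>F t in nhds 0. \<phi> t \<le> \<phi> 0"
      using eventually_compose_filterlim[OF max line] by (simp add: \<phi>_def)
    then obtain d0 where d0: "d0 > 0" "\<forall>t. dist t 0 < d0 \<longrightarrow> \<phi> t \<le> \<phi> 0"
      unfolding eventually_nhds_metric by blast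
    have "g 0 = 0"
      using d0 by (intro DERIV_local_max[OF eventually_nhds_x_imp_x[OF phi] d0(1)])
        (simp add: dist_real_def)
    then have "\<exists>d>0. \<forall>h>0. h < d \<longrightarrow> 0 < g h"
      using DERIV_pos_inc_right[OF g pos] by simp
    then obtain d1 where d1: "d1 > 0" "\<forall>h>0. h < d1 \<longrightarrow> g h > 0"
      by blast
    from phi obtain d2 where d2: "d2 > 0" "\<forall>t. dist t 0 < d2 \<longrightarrow> DERIV \<phi> t :> g t"
      unfolding eventually_nhds_metric by blast
    define e where "e = min d0 (min d1 d2) / 2"
    have e: "0 < e" "e < d0" "e < d1" "e < d2" using d0 d1 d2 by (auto simp: e_def)
    have "\<phi> 0 < \<phi> e"
    proof (rule DERIV_pos_imp_increasing_open[OF e(1)])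
      show "\<And>x. 0 < x \<Longrightarrow> x < e \<Longrightarrow> \<exists>y. DERIV \<phi> x :> y \<and> y > 0"
      proof -
        fix x assume "0 < x" "x < e"
        then have "g x > 0" "dist x 0 < d2" using d1(2) e by (auto simp: dist_real_def)
        then show "\<exists>y. DERIV \<phi> x :> y \<and> y > 0" using d2(2) by blast
      qed
      show "continuous_on {0..e} \<phi>"
      proof (intro continuous_at_imp_continuous_on ballI)
        fix x assume "x \<in> {0..e}"
        then have "dist x 0 < d2" using e by simp
        then have "DERIV \<phi> x :> g x" using d2(2) by blast
        then show "isCont \<phi> x" by (rule DERIV_isCont)
      qed
    qed
    moreover have "\<phi> e \<le> \<phi> 0" using d0(2) e by simp
    ultimately show False by simp
  qed
  then show ?thesis unfolding l[symmetric] by (intro sum_nonpos) simp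
qed

section \<open>The gradient of a harmonic function\<close>

text \<open>The mean value theorem along \<open>b\<close>, followed by the first order expansion of \<open>G\<close> at \<open>z\<close>. The second
  difference is symmetric in \<open>a\<close> and \<open>b\<close>, its approximation is not visibly so; comparing the two gives
  the symmetry of the second derivative under bare differentiability of the gradient.\<close>

lemma second_difference_approx:
  fixes u :: "'a::real_inner \<Rightarrow> real"
  assumes G: "\<forall>\<^sub>F w in nhds z. GDERIV u w :> G w" and H: "(G has_derivative H) (at z)"
    and "e > 0"
  shows "\<exists>d>0. \<forall>t. 0 < t \<and> t < d \<longrightarrow>
    \<bar>(u (z + t *\<^sub>R a + t *\<^sub>R b) - u (z + t *\<^sub>R a) - u (z + t *\<^sub>R b) + u z) - t\<^sup>2 * (H a \<bullet> b)\<bar> \<le> e * t\<^sup>2"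
proof -
  define B where "B = norm a + norm b"
  have B: "norm a \<le> B" "norm b \<le> B" "B \<ge> 0" by (auto simp: B_def)
  \<comment> \<open>Each of the two remainders of \<open>G\<close> is at most \<open>e' * (t * B)\<close>, and the inner product with \<open>b\<close> costs
    another factor \<open>B\<close>; the summand \<open>1\<close> covers the case \<open>B = 0\<close>.\<close>
  define e' where "e' = e / (2 * B * B + 1)"
  have e': "e' > 0" "2 * e' * B * B \<le> e"
    using \<open>e > 0\<close> B by (auto simp: e'_def divide_simps add_nonneg_pos)
  interpret H: bounded_linear H using H by (rule has_derivative_bounded_linear)
  from H e'(1) obtain d1 where d1: "d1 > 0"
    "\<And>y. norm (y - z) < d1 \<Longrightarrow> norm (G y - G z - H (y - z)) \<le> e' * norm (y - z)"
    unfolding has_derivative_at_alt by blast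
  from G obtain d2 where d2: "d2 > 0" "\<And>y. dist y z < d2 \<Longrightarrow> GDERIV u y :> G y"
    unfolding eventually_nhds_metric by blast
  define d where "d = min d1 d2 / (B + 1)"
  have "d > 0" using d1 d2 B by (auto simp: d_def)
  moreover have "\<bar>(u (z + t *\<^sub>R a + t *\<^sub>R b) - u (z + t *\<^sub>R a) - u (z + t *\<^sub>R b) + u z) - t\<^sup>2 * (H a \<bullet> b)\<bar>
      \<le> e * t\<^sup>2" if t: "0 < t" "t < d" for t
  proof -
    have tB: "t * B < min d1 d2"
    proof -
      have "t * B \<le> t * (B + 1)" using t by simp
      also have "\<dots> < min d1 d2" using t(2) B by (simp add: d_def field_simps)
      finally show ?thesis .
    qed
    have near: "norm (s *\<^sub>R b + r *\<^sub>R a) \<le> t * B" if "0 \<le> s" "s \<le> t" "0 \<le> r" "r \<le> t" for s r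
    proof -
      have "norm (s *\<^sub>R b + r *\<^sub>R a) \<le> s * norm b + r * norm a"
        using that norm_triangle_ineq[of "s *\<^sub>R b" "r *\<^sub>R a"] by simp
      also have "\<dots> \<le> t * norm b + t * norm a"
        using that by (intro add_mono mult_right_mono) auto
      also have "\<dots> = t * B" by (simp add: B_def algebra_simps)
      finally show ?thesis .
    qed
    define \<phi> where "\<phi> s = u (z + (s *\<^sub>R b + t *\<^sub>R a)) - u (z + (s *\<^sub>R b + 0 *\<^sub>R a))" for s
    define \<psi> where "\<psi> s = (G (z + (s *\<^sub>R b + t *\<^sub>R a)) - G (z + (s *\<^sub>R b + 0 *\<^sub>R a))) \<bullet> b" for s
    have line: "((\<lambda>s. u (z + (s *\<^sub>R b + r *\<^sub>R a))) has_real_derivative G (z + (s *\<^sub>R b + r *\<^sub>R a)) \<bullet> b) (at s)"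
      if "0 \<le> s" "s \<le> t" "0 \<le> r" "r \<le> t" for s r
    proof -
      have "dist (z + (s *\<^sub>R b + r *\<^sub>R a)) z < d2"
        using near[OF that] tB by (simp add: dist_norm)
      then have "(u has_derivative (\<lambda>h. h \<bullet> G (z + (s *\<^sub>R b + r *\<^sub>R a)))) (at (z + (s *\<^sub>R b + r *\<^sub>R a)))"
        using d2(2) unfolding gderiv_def by blast
      moreover have "((\<lambda>s. z + (s *\<^sub>R b + r *\<^sub>R a)) has_derivative (\<lambda>s. s *\<^sub>R b)) (at s)"
        by (auto intro!: derivative_eq_intros)
      ultimately have "((\<lambda>s. u (z + (s *\<^sub>R b + r *\<^sub>R a))) has_derivative
          (\<lambda>h. (h *\<^sub>R b) \<bullet> G (z + (s *\<^sub>R b + r *\<^sub>R a)))) (at s)"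
        using has_derivative_compose by blast
      then show ?thesis
        unfolding has_field_derivative_def by (simp add: inner_commute mult.commute[of _ "_ \<bullet> _"])
    qed
    have "\<exists>\<xi>. 0 < \<xi> \<and> \<xi> < t \<and> \<phi> t - \<phi> 0 = (t - 0) * \<psi> \<xi>"
    proof (rule MVT2[OF t(1)])
      fix s assume s: "0 \<le> s" "s \<le> t"
      show "DERIV \<phi> s :> \<psi> s"
        unfolding \<phi>_def \<psi>_def inner_diff_left
        using s t by (intro DERIV_diff line) auto
    qed
    then obtain \<xi> where \<xi>: "0 < \<xi>" "\<xi> < t" "\<phi> t - \<phi> 0 = t * \<psi> \<xi>" by auto
    have est: "norm (G (z + v) - G z - H v) \<le> e' * (t * B)" if "norm v \<le> t * B" for v
    proof -
      have "norm (G (z + v) - G z - H v) \<le> e' * norm v"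
        using d1(2)[of "z + v"] that tB by simp
      also have "\<dots> \<le> e' * (t * B)" using that e'(1) by simp
      finally show ?thesis .
    qed
    define v1 v0 where "v1 = \<xi> *\<^sub>R b + t *\<^sub>R a" and "v0 = \<xi> *\<^sub>R b + 0 *\<^sub>R a"
    have "norm v1 \<le> t * B" "norm v0 \<le> t * B"
      unfolding v1_def v0_def using \<xi> t by (intro near; simp)+
    then have est': "norm ((G (z + v1) - G z - H v1) - (G (z + v0) - G z - H v0)) \<le> e' * (t * B) + e' * (t * B)"
      by (intro norm_triangle_le_diff add_mono est)
    have "H v1 - H v0 = t *\<^sub>R H a"
      by (simp add: v1_def v0_def H.add H.scaleR)
    then have eq: "(G (z + v1) - G (z + v0)) - t *\<^sub>R H a = (G (z + v1) - G z - H v1) - (G (z + v0) - G z - H v0)"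
      by (simp add: algebra_simps)
    have "\<bar>((G (z + v1) - G (z + v0)) - t *\<^sub>R H a) \<bullet> b\<bar> \<le> (e' * (t * B) + e' * (t * B)) * B"
    proof -
      have "\<bar>((G (z + v1) - G (z + v0)) - t *\<^sub>R H a) \<bullet> b\<bar>
          \<le> norm ((G (z + v1) - G (z + v0)) - t *\<^sub>R H a) * norm b"
        by (rule Cauchy_Schwarz_ineq2)
      also have "\<dots> \<le> (e' * (t * B) + e' * (t * B)) * B"
        using est' B e'(1) t unfolding eq by (intro mult_mono) auto
      finally show ?thesis .
    qed
    then have "\<bar>\<psi> \<xi> - t * (H a \<bullet> b)\<bar> \<le> t * (2 * e' * B * B)"
      by (simp add: \<psi>_def v1_def v0_def inner_diff_left algebra_simps)
    also have "\<dots> \<le> t * e" using e' t by simp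
    finally have "t * \<bar>\<psi> \<xi> - t * (H a \<bullet> b)\<bar> \<le> t * (t * e)" using t by simp
    moreover have "t * \<bar>\<psi> \<xi> - t * (H a \<bullet> b)\<bar> = \<bar>(\<phi> t - \<phi> 0) - t\<^sup>2 * (H a \<bullet> b)\<bar>"
    proof -
      have "t * \<bar>\<psi> \<xi> - t * (H a \<bullet> b)\<bar> = \<bar>t * (\<psi> \<xi> - t * (H a \<bullet> b))\<bar>"
        using t by (simp add: abs_mult)
      then show ?thesis unfolding \<xi>(3) by (simp add: power2_eq_square right_diff_distrib mult.assoc)
    qed
    moreover have "\<phi> t - \<phi> 0 = u (z + t *\<^sub>R a + t *\<^sub>R b) - u (z + t *\<^sub>R a) - u (z + t *\<^sub>R b) + u z"
      by (simp add: \<phi>_def algebra_simps)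
    ultimately show ?thesis by (simp add: power2_eq_square algebra_simps)
  qed
  ultimately show ?thesis by blast
qed

lemma second_derivative_symmetric:
  fixes u :: "'a::real_inner \<Rightarrow> real"
  assumes G: "\<forall>\<^sub>F w in nhds z. GDERIV u w :> G w" and H: "(G has_derivative H) (at z)"
  shows "H a \<bullet> b = H b \<bullet> a"
proof -
  have "\<bar>H a \<bullet> b - H b \<bullet> a\<bar> \<le> e" if "e > 0" for e
  proof -
    have e2: "e / 2 > 0" using that by simp
    obtain d1 d2 where d: "d1 > 0" "d2 > 0" and
      1: "\<And>t. 0 < t \<and> t < d1 \<Longrightarrow> \<bar>(u (z + t *\<^sub>R a + t *\<^sub>R b) - u (z + t *\<^sub>R a) - u (z + t *\<^sub>R b) + u z)
          - t\<^sup>2 * (H a \<bullet> b)\<bar> \<le> e / 2 * t\<^sup>2" and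
      2: "\<And>t. 0 < t \<and> t < d2 \<Longrightarrow> \<bar>(u (z + t *\<^sub>R b + t *\<^sub>R a) - u (z + t *\<^sub>R b) - u (z + t *\<^sub>R a) + u z)
          - t\<^sup>2 * (H b \<bullet> a)\<bar> \<le> e / 2 * t\<^sup>2"
      using second_difference_approx[OF G H e2, of a b] second_difference_approx[OF G H e2, of b a]
      by blast
    define t where "t = min d1 d2 / 2"
    have t: "0 < t" "t < d1" "t < d2" using d by (auto simp: t_def)
    have "\<bar>t\<^sup>2 * (H a \<bullet> b) - t\<^sup>2 * (H b \<bullet> a)\<bar> \<le> e / 2 * t\<^sup>2 + e / 2 * t\<^sup>2"
    proof -
      have eq: "z + t *\<^sub>R b + t *\<^sub>R a = z + t *\<^sub>R a + t *\<^sub>R b" by (simp add: ac_simps)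
      have "\<bar>(u (z + t *\<^sub>R a + t *\<^sub>R b) - u (z + t *\<^sub>R b) - u (z + t *\<^sub>R a) + u z)
          - t\<^sup>2 * (H b \<bullet> a)\<bar> \<le> e / 2 * t\<^sup>2"
        using 2[of t, unfolded eq] t by blast
      moreover have "\<bar>(u (z + t *\<^sub>R a + t *\<^sub>R b) - u (z + t *\<^sub>R a) - u (z + t *\<^sub>R b) + u z)
          - t\<^sup>2 * (H a \<bullet> b)\<bar> \<le> e / 2 * t\<^sup>2"
        using 1[of t] t by blast
      ultimately show ?thesis by linarith
    qed
    then have "t\<^sup>2 * \<bar>H a \<bullet> b - H b \<bullet> a\<bar> \<le> t\<^sup>2 * e"
      unfolding right_diff_distrib[symmetric] abs_mult by (simp add: algebra_simps)
    then show ?thesis using t by simp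
  qed
  then have "\<bar>H a \<bullet> b - H b \<bullet> a\<bar> \<le> 0" by (rule field_le_epsilon[of _ 0, simplified])
  then show ?thesis by simp
qed

lemma GDERIV_unique: "GDERIV f x :> D \<Longrightarrow> GDERIV f x :> E \<Longrightarrow> D = E"
  unfolding gderiv_def by (metis has_derivative_unique vector_eq_ldot)

lemma harmonic_on_gradient:
  assumes "harmonic_on u S" "open S" and G: "\<And>x. x \<in> S \<Longrightarrow> GDERIV u x :> G x" and "z \<in> S"
  obtains H where "(G has_derivative H) (at z)" "(\<Sum>b\<in>Basis. H b \<bullet> b) = 0"
proof -
  from assms(1) obtain G' H where *: "\<forall>z\<in>S. GDERIV u z :> G' z" "\<forall>z\<in>S. (G' has_derivative H z) (at z)"
    "\<forall>z\<in>S. (\<Sum>b\<in>Basis. H z b \<bullet> b) = 0"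
    unfolding harmonic_on_def by blast
  have "G' x = G x" if "x \<in> S" for x
    using *(1) G that GDERIV_unique by blast
  moreover have "(G' has_derivative H z) (at z)" using * \<open>z \<in> S\<close> by blast
  ultimately have "(G has_derivative H z) (at z)"
    using has_derivative_transform_within_open[OF _ \<open>open S\<close> \<open>z \<in> S\<close>] by blast
  then show thesis using that * \<open>z \<in> S\<close> by blast
qed

text \<open>The Cauchy-Riemann equations for \<open>cnj G\<close> are the vanishing of the Laplacian of \<open>u\<close> and the symmetry of
  its Hessian.\<close>

lemma cnj_gradient_holomorphic:
  fixes u :: "complex \<Rightarrow> real"
  assumes "harmonic_on u S" "open S" and G: "\<And>x. x \<in> S \<Longrightarrow> GDERIV u x :> G x"
  shows "(\<lambda>z. cnj (G z)) holomorphic_on S"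
proof -
  have "\<exists>c. ((\<lambda>z. cnj (G z)) has_field_derivative c) (at z)" if zS: "z \<in> S" for z
  proof -
    obtain H where H: "(G has_derivative H) (at z)" "(\<Sum>b\<in>Basis. H b \<bullet> b) = 0"
      using harmonic_on_gradient[OF assms zS] by blast
    interpret H: bounded_linear H using H(1) by (rule has_derivative_bounded_linear)
    have "\<forall>\<^sub>F w in nhds z. GDERIV u w :> G w"
      using eventually_nhds_in_open[OF assms(2) zS] G by (auto elim: eventually_mono)
    then have "H 1 \<bullet> \<i> = H \<i> \<bullet> 1" using H(1) by (rule second_derivative_symmetric)
    then have CR: "Im (H 1) = Re (H \<i>)" "Im (H \<i>) = - Re (H 1)"
      using H(2) by (auto simp: Basis_complex_def inner_complex_def)
    have "cnj (H v) = cnj (H 1) * v" for v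
    proof -
      have "v = Re v *\<^sub>R 1 + Im v *\<^sub>R \<i>" by (simp add: complex_eq_iff)
      then have "H v = H (Re v *\<^sub>R 1 + Im v *\<^sub>R \<i>)" by (rule arg_cong)
      also have "\<dots> = Re v *\<^sub>R H 1 + Im v *\<^sub>R H \<i>" by (simp only: H.add H.scaleR)
      finally have "H v = Re v *\<^sub>R H 1 + Im v *\<^sub>R H \<i>" .
      then show ?thesis using CR by (simp add: complex_eq_iff)
    qed
    then have eq: "(\<lambda>v. cnj (H v)) = (*) (cnj (H 1))" by (rule ext)
    have "((\<lambda>z. cnj (G z)) has_field_derivative cnj (H 1)) (at z)"
      unfolding has_field_derivative_def eq[symmetric] by (rule has_derivative_cnj[OF H(1)])
    then show ?thesis by blast
  qed
  then show ?thesis using \<open>open S\<close> by (auto simp: holomorphic_on_open)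
qed

section \<open>Comparison with exponentials of harmonic functions\<close>

lemma harmonic_on_imp_continuous_on:
  assumes "harmonic_on u S" shows "continuous_on S u"
proof -
  from assms obtain G where "\<forall>z\<in>S. GDERIV u z :> G z" unfolding harmonic_on_def by blast
  then show ?thesis unfolding gderiv_def
    by (meson continuous_at_imp_continuous_on has_derivative_continuous)
qed

text \<open>The maximum principle for \<open>\<Psi> = b * exp (N * \<tau>) * exp \<bar>z\<bar>\<^sup>2\<close>. If the conclusion fails, \<open>\<Psi>\<close> exceeds its
  boundary limits and attains its maximum in \<open>\<Omega>\<close>. There \<open>b\<close> is still above the threshold
  \<open>K * exp (- N * \<tau>)\<close>, hence \<open>ln \<Psi>\<close> is defined near the maximum, and its Laplacian is
  positive because \<open>\<bar>z\<bar>\<^sup>2\<close> contributes \<open>4\<close>. The condition on the Laplacian is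
  restricted to points above the threshold so that zeros of \<open>b\<close>, and points where \<open>ln b\<close> is far from subharmonic,
  do no harm.\<close>

lemma exponential_comparison:
  fixes b \<tau> :: "complex \<Rightarrow> real"
  assumes "open \<Omega>" and R: "\<And>z. z \<in> \<Omega> \<Longrightarrow> norm z \<le> R" and "K > 0"
    and cb: "continuous_on \<Omega> b" and ct: "continuous_on \<Omega> \<tau>"
    and lap: "\<And>z. z \<in> \<Omega> \<Longrightarrow> b z > K * exp (- N * \<tau> z) \<Longrightarrow>
           \<exists>l>-4. has_laplacian (\<lambda>w. ln (b w) + N * \<tau> w) z l"
    and bd: "\<And>p m. p \<in> frontier \<Omega> \<Longrightarrow> m > K \<Longrightarrow> \<forall>\<^sub>F z in at p within \<Omega>. b z * exp (N * \<tau> z) < m"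
    and z0: "z0 \<in> \<Omega>"
  shows "b z0 \<le> K * exp (R\<^sup>2) * exp (- N * \<tau> z0)"
proof (rule ccontr)
  assume contr: "\<not> ?thesis"
  define \<Psi> where "\<Psi> z = b z * exp (N * \<tau> z) * exp ((norm z)\<^sup>2)" for z
  have R2: "exp ((norm z)\<^sup>2) \<le> exp (R\<^sup>2)" if "z \<in> \<Omega>" for z
    using R[OF that] by (simp add: power_mono)
  have "K * exp (R\<^sup>2) < b z0 * exp (N * \<tau> z0)"
    using contr by (simp add: exp_minus field_simps)
  moreover from this have "b z0 * exp (N * \<tau> z0) * 1 \<le> \<Psi> z0"
  proof -
    have "0 \<le> K * exp (R\<^sup>2)" using \<open>K > 0\<close> by simp
    then have "0 \<le> b z0 * exp (N * \<tau> z0)" using \<open>K * exp (R\<^sup>2) < b z0 * exp (N * \<tau> z0)\<close> by linarith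
    then show ?thesis unfolding \<Psi>_def by (intro mult_left_mono) auto
  qed
  ultimately have big: "K * exp (R\<^sup>2) < \<Psi> z0" by simp
  have pos: "\<Psi> z0 > 0" using big \<open>K > 0\<close> by (meson exp_gt_zero less_trans mult_pos_pos)
  have c\<Psi>: "continuous_on \<Omega> \<Psi>"
    unfolding \<Psi>_def by (intro continuous_intros cb ct)
  define S where "S = {z \<in> \<Omega>. \<Psi> z \<ge> \<Psi> z0}"
  \<comment> \<open>Closed in the whole plane, not only relative to \<open>\<Omega>\<close>: the boundary condition keeps the superlevel set
    away from the boundary.\<close>
  have "closed S"
  proof -
    have "x \<in> S" if x: "x \<in> closure S" for x
    proof (cases "x \<in> \<Omega>")
      case True
      have "closedin (top_of_set \<Omega>) (\<Omega> \<inter> \<Psi> -` {\<Psi> z0..})"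
        by (rule continuous_closedin_preimage[OF c\<Psi>]) simp
      moreover have "\<Omega> \<inter> \<Psi> -` {\<Psi> z0..} = S" by (auto simp: S_def)
      ultimately obtain T where "closed T" "S = \<Omega> \<inter> T" by (auto simp: closedin_closed)
      then show ?thesis using x True closure_minimal[of S T] by blast
    next
      case False
      have "x \<in> closure \<Omega>" using x closure_mono[of S \<Omega>] by (auto simp: S_def)
      then have fr: "x \<in> frontier \<Omega>"
        using False \<open>open \<Omega>\<close> by (simp add: frontier_def interior_open)
      have "\<Psi> z0 / exp (R\<^sup>2) > K" using big by (simp add: field_simps)
      from bd[OF fr this] have "\<forall>\<^sub>F z in at x within S. b z * exp (N * \<tau> z) < \<Psi> z0 / exp (R\<^sup>2)"
        by (rule filter_leD[rotated]) (auto intro!: at_le simp: S_def)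
      moreover have "\<forall>\<^sub>F z in at x within S. z \<in> \<Omega>"
        by (auto simp: eventually_at_filter S_def)
      ultimately have "\<forall>\<^sub>F z in at x within S. \<Psi> z < \<Psi> z0"
      proof eventually_elim
        case (elim z)
        define q where "q = \<Psi> z0 / exp (R\<^sup>2)"
        have "q > 0" "\<Psi> z0 = q * exp (R\<^sup>2)" using pos by (auto simp: q_def)
        have "\<Psi> z < q * exp ((norm z)\<^sup>2)"
          unfolding \<Psi>_def using elim(1) unfolding q_def[symmetric]
          by (rule mult_strict_right_mono) simp
        also have "\<dots> \<le> q * exp (R\<^sup>2)"
          using R2[OF elim(2)] \<open>q > 0\<close> by simp
        finally show ?case using \<open>\<Psi> z0 = q * exp (R\<^sup>2)\<close> by simp
      qed
      moreover have "\<forall>\<^sub>F z in at x within S. \<Psi> z \<ge> \<Psi> z0"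
        by (auto simp: eventually_at_filter S_def)
      ultimately have "\<forall>\<^sub>F z in at x within S. False"
        by eventually_elim simp
      moreover have "at x within S \<noteq> bot"
        using x False by (auto simp: S_def closure_def trivial_limit_within)
      ultimately show ?thesis by (simp add: trivial_limit_def)
    qed
    then show ?thesis by (metis closure_subset closure_eq subsetI subset_antisym)
  qed
  moreover have "bounded S" using R by (auto simp: bounded_iff S_def)
  ultimately have "compact S" by (simp add: compact_eq_bounded_closed)
  moreover have "z0 \<in> S" using z0 by (simp add: S_def)
  moreover have "continuous_on S \<Psi>" using c\<Psi> by (rule continuous_on_subset) (auto simp: S_def)
  ultimately obtain z1 where z1: "z1 \<in> S" "\<And>z. z \<in> S \<Longrightarrow> \<Psi> z \<le> \<Psi> z1"
    using continuous_attains_sup[of S \<Psi>] by blast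
  then have z1\<Omega>: "z1 \<in> \<Omega>" "\<Psi> z1 \<ge> \<Psi> z0" by (auto simp: S_def)
  have max: "\<Psi> z \<le> \<Psi> z1" if "z \<in> \<Omega>" for z
    using z1(2)[of z] z1\<Omega> that by (cases "\<Psi> z \<ge> \<Psi> z0") (auto simp: S_def)
  have "K * exp ((norm z1)\<^sup>2) < b z1 * exp (N * \<tau> z1) * exp ((norm z1)\<^sup>2)"
  proof -
    have "K * exp ((norm z1)\<^sup>2) \<le> K * exp (R\<^sup>2)"
      using R2[OF z1\<Omega>(1)] \<open>K > 0\<close> by (intro mult_left_mono) auto
    then show ?thesis using big z1\<Omega>(2) unfolding \<Psi>_def[of z1] by linarith
  qed
  then have gt: "b z1 > K * exp (- N * \<tau> z1)" by (simp add: exp_minus field_simps)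
  then have bpos: "b z1 > 0" using \<open>K > 0\<close> by (meson exp_gt_zero less_trans mult_pos_pos)
  obtain l where l: "l > -4" "has_laplacian (\<lambda>w. ln (b w) + N * \<tau> w) z1 l"
    using lap[OF z1\<Omega>(1) gt] by blast
  have "has_laplacian (\<lambda>w. ln (b w) + N * \<tau> w + (norm w)\<^sup>2) z1 (l + 4)"
    by (rule has_laplacian_add[OF l(2) has_laplacian_norm_squared])
  moreover have "\<forall>\<^sub>F w in nhds z1. ln (b w) + N * \<tau> w + (norm w)\<^sup>2 \<le> ln (b z1) + N * \<tau> z1 + (norm z1)\<^sup>2"
  proof -
    have "isCont b z1" using cb \<open>open \<Omega>\<close> z1\<Omega>(1) by (simp add: continuous_on_eq_continuous_at)
    then have "\<forall>\<^sub>F w in nhds z1. b w > 0"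
      using bpos unfolding continuous_at tendsto_at_iff_tendsto_nhds by (rule order_tendstoD(1))
    with eventually_nhds_in_open[OF \<open>open \<Omega>\<close> z1\<Omega>(1)] show ?thesis
    proof eventually_elim
      case (elim w)
      have "ln (\<Psi> x) = ln (b x) + N * \<tau> x + (norm x)\<^sup>2" if "b x > 0" for x
        using that by (simp add: \<Psi>_def ln_mult)
      moreover have "ln (\<Psi> w) \<le> ln (\<Psi> z1)"
        using max[OF elim(1)] elim(2) by (intro ln_mono) (auto simp: \<Psi>_def)
      ultimately show ?case using elim(2) bpos by simp
    qed
  qed
  ultimately have "l + 4 \<le> 0" by (rule laplacian_nonpos_at_local_max)
  then show False using l(1) by simp
qed

text \<open>Above the threshold \<open>u\<close> exceeds the norm of its gradient, so that the Laplacian of \<open>ln u\<close> is at least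
  \<open>-1\<close>.\<close>

lemma harmonic_upper_bound:
  fixes u \<tau> :: "complex \<Rightarrow> real"
  assumes \<Omega>: "open \<Omega>" and R: "\<And>z. z \<in> \<Omega> \<Longrightarrow> norm z \<le> R" and K: "K > 0"
    and G: "\<And>z. z \<in> \<Omega> \<Longrightarrow> GDERIV u z :> G z"
    and H: "\<And>z. z \<in> \<Omega> \<Longrightarrow> \<exists>H. (G has_derivative H) (at z) \<and> (\<Sum>b\<in>Basis. H b \<bullet> b) = 0"
    and \<tau>: "harmonic_on \<tau> \<Omega>"
    and grad: "\<And>z. z \<in> \<Omega> \<Longrightarrow> norm (G z) \<le> K * exp (- N * \<tau> z)"
    and bd: "\<And>p m. p \<in> frontier \<Omega> \<Longrightarrow> m > K \<Longrightarrow> \<forall>\<^sub>F z in at p within \<Omega>. u z * exp (N * \<tau> z) < m"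
    and z: "z \<in> \<Omega>"
  shows "u z \<le> K * exp (R\<^sup>2) * exp (- N * \<tau> z)"
proof (rule exponential_comparison[OF \<Omega> R K _ harmonic_on_imp_continuous_on[OF \<tau>] _ bd z])
  show "continuous_on \<Omega> u"
    using G unfolding gderiv_def
    by (meson continuous_at_imp_continuous_on has_derivative_continuous)
next
  fix z assume z: "z \<in> \<Omega>" and big: "u z > K * exp (- N * \<tau> z)"
  have pos: "u z > 0" using big K by (meson exp_gt_zero less_trans mult_pos_pos)
  obtain H where H: "(G has_derivative H) (at z)" "(\<Sum>b\<in>Basis. H b \<bullet> b) = 0"
    using H[OF z] by blast
  have "\<forall>\<^sub>F w in nhds z. GDERIV u w :> G w"
    using eventually_nhds_in_open[OF \<Omega> z] G by (auto elim: eventually_mono)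
  then have "has_laplacian (\<lambda>w. ln (u w)) z (- (norm (G z) / u z)\<^sup>2)"
    using H pos by (rule has_laplacian_ln)
  moreover have "has_laplacian (\<lambda>w. N * \<tau> w) z (N * 0)"
    by (intro has_laplacian_cmult harmonic_on_has_laplacian[OF \<tau> \<Omega> z])
  ultimately have "has_laplacian (\<lambda>w. ln (u w) + N * \<tau> w) z (- (norm (G z) / u z)\<^sup>2 + N * 0)"
    by (rule has_laplacian_add)
  moreover have "- (norm (G z) / u z)\<^sup>2 + N * 0 > -4"
  proof -
    have "norm (G z) / u z \<le> 1" using grad[OF z] big pos by (simp add: divide_simps)
    then have "(norm (G z) / u z)\<^sup>2 \<le> 1" using pos by (simp add: power_le_one)
    then show ?thesis by simp
  qed
  ultimately show "\<exists>l>-4. has_laplacian (\<lambda>w. ln (u w) + N * \<tau> w) z l" by blast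
qed

lemma gradient_upper_bound:
  fixes u \<tau> :: "complex \<Rightarrow> real"
  assumes \<Omega>: "open \<Omega>" and R: "\<And>z. z \<in> \<Omega> \<Longrightarrow> norm z \<le> R" and K: "K > 0"
    and u: "harmonic_on u \<Omega>" and G: "\<And>z. z \<in> \<Omega> \<Longrightarrow> GDERIV u z :> G z"
    and \<tau>: "harmonic_on \<tau> \<Omega>"
    and bd: "\<And>p m. p \<in> frontier \<Omega> \<Longrightarrow> m > K \<Longrightarrow> \<forall>\<^sub>F z in at p within \<Omega>. norm (G z) * exp (N * \<tau> z) < m"
    and z: "z \<in> \<Omega>"
  shows "norm (G z) \<le> K * exp (R\<^sup>2) * exp (- N * \<tau> z)"
proof (rule exponential_comparison[OF \<Omega> R K _ harmonic_on_imp_continuous_on[OF \<tau>] _ bd z])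
  have h: "(\<lambda>z. cnj (G z)) holomorphic_on \<Omega>" by (rule cnj_gradient_holomorphic[OF u \<Omega> G])
  then have "continuous_on \<Omega> (\<lambda>z. norm (cnj (G z)))"
    by (intro continuous_on_norm holomorphic_on_imp_continuous_on)
  then show "continuous_on \<Omega> (\<lambda>z. norm (G z))" by simp
  fix z assume z: "z \<in> \<Omega>" and big: "norm (G z) > K * exp (- N * \<tau> z)"
  have pos: "norm (G z) > 0" using big K by (meson exp_gt_zero less_trans mult_pos_pos)
  then have "has_laplacian (\<lambda>w. ln (norm (cnj (G w)))) z 0"
    by (intro has_laplacian_ln_norm_holomorphic[OF \<Omega> z h]) simp
  moreover have "has_laplacian (\<lambda>w. N * \<tau> w) z (N * 0)"
    by (intro has_laplacian_cmult harmonic_on_has_laplacian[OF \<tau> \<Omega> z])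
  ultimately have "has_laplacian (\<lambda>w. ln (norm (cnj (G w))) + N * \<tau> w) z (0 + N * 0)"
    by (rule has_laplacian_add)
  then show "\<exists>l>-4. has_laplacian (\<lambda>w. ln (norm (G w)) + N * \<tau> w) z l"
    by (intro exI[of _ 0]) simp
qed

text \<open>The exponential comparison, once for the gradient and once for \<open>u\<close> and \<open>- u\<close>, each time at the price of
  a factor \<open>exp (R\<^sup>2)\<close>. Both \<open>\<bar>u\<bar>\<close> and \<open>\<bar>G\<bar>\<close> satisfy the boundary condition with the constant \<open>A\<close>: on
  \<open>closure \<Gamma>\<close> because \<open>\<epsilon> * exp N = 1 \<le> A\<close> and \<open>\<tau> \<le> 1\<close>, elsewhere because \<open>\<tau>\<close> tends to \<open>0\<close>.\<close>

lemma interior_estimate: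
  fixes u \<tau> :: "complex \<Rightarrow> real" and G :: "complex \<Rightarrow> complex"
  assumes \<Omega>: "open \<Omega>" and R: "\<And>z. z \<in> \<Omega> \<Longrightarrow> norm z \<le> R" and A: "A \<ge> 1"
    and u: "harmonic_on u \<Omega>" and C1: "C1_closure_with_gradient \<Omega> u G"
    and bound: "\<And>z. z \<in> closure \<Omega> \<Longrightarrow> \<bar>u z\<bar> \<le> A" "\<And>z. z \<in> closure \<Omega> \<Longrightarrow> norm (G z) \<le> A"
    and \<tau>: "is_harmonic_measure \<Omega> \<Gamma> \<tau>"
    and \<epsilon>: "0 < \<epsilon>" "\<epsilon> < 1"
    and small: "\<And>p. p \<in> frontier \<Omega> \<inter> closure \<Gamma> \<Longrightarrow> \<bar>u p\<bar> \<le> \<epsilon>"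
               "\<And>p. p \<in> frontier \<Omega> \<inter> closure \<Gamma> \<Longrightarrow> norm (G p) \<le> \<epsilon>"
    and z: "z \<in> \<Omega>"
  shows "\<bar>u z\<bar> \<le> A * exp (2 * R\<^sup>2) * \<epsilon> powr \<tau> z"
proof -
  define N where "N = - ln \<epsilon>"
  have N: "N > 0" "exp N = 1 / \<epsilon>" using \<epsilon> by (auto simp: N_def exp_minus field_simps)
  have cu: "continuous_on (closure \<Omega>) u" and cG: "continuous_on (closure \<Omega>) G"
    and G: "\<And>x. x \<in> \<Omega> \<Longrightarrow> GDERIV u x :> G x"
    using C1 by (auto simp: C1_closure_with_gradient_def)
  have \<tau>h: "harmonic_on \<tau> \<Omega>" and \<tau>1: "\<And>z. z \<in> \<Omega> \<Longrightarrow> \<tau> z \<le> 1"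
    and \<tau>0: "\<And>p. p \<in> frontier \<Omega> - closure \<Gamma> \<Longrightarrow> (\<tau> \<longlongrightarrow> 0) (at p within \<Omega>)"
    using \<tau> by (auto simp: is_harmonic_measure_def)
  have bd: "\<forall>\<^sub>F z in at p within \<Omega>. c z * exp (N * \<tau> z) < m"
    if c: "continuous_on (closure \<Omega>) c" "\<And>z. c z \<ge> 0" "\<And>z. z \<in> closure \<Omega> \<Longrightarrow> c z \<le> A"
       "\<And>p. p \<in> frontier \<Omega> \<inter> closure \<Gamma> \<Longrightarrow> c p \<le> \<epsilon>" and p: "p \<in> frontier \<Omega>" and m: "m > A"
    for c :: "complex \<Rightarrow> real" and p m
  proof -
    have pc: "p \<in> closure \<Omega>" using p by (simp add: frontier_def)
    have lim: "(c \<longlongrightarrow> c p) (at p within \<Omega>)"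
      using c(1) pc unfolding continuous_on_def
      by (meson closure_subset tendsto_within_subset)
    show ?thesis
    proof (cases "p \<in> closure \<Gamma>")
      case True
      have "c p * exp N \<le> 1" using c(4)[of p] p True \<epsilon> by (simp add: N divide_simps)
      then have "c p * exp N < m" using m A by linarith
      moreover have "((\<lambda>z. c z * exp N) \<longlongrightarrow> c p * exp N) (at p within \<Omega>)"
        by (intro tendsto_intros lim)
      ultimately have "\<forall>\<^sub>F z in at p within \<Omega>. c z * exp N < m"
        by (metis order_tendstoD(2))
      moreover have "\<forall>\<^sub>F z in at p within \<Omega>. z \<in> \<Omega>"
        by (simp add: eventually_at_filter)
      ultimately show ?thesis
      proof eventually_elim
        case (elim z)
        have "exp (N * \<tau> z) \<le> exp N" using \<tau>1[OF elim(2)] N(1) by simp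
        then have "c z * exp (N * \<tau> z) \<le> c z * exp N"
          using c(2)[of z] by (rule mult_left_mono)
        then show ?case using elim(1) by simp
      qed
    next
      case False
      then have "((\<lambda>z. c z * exp (N * \<tau> z)) \<longlongrightarrow> c p * exp (N * 0)) (at p within \<Omega>)"
        using p by (intro tendsto_intros lim \<tau>0) simp
      moreover have "c p * exp (N * 0) < m" using c(3)[OF pc] m by simp
      ultimately show ?thesis by (metis order_tendstoD(2))
    qed
  qed
  define K where "K = A * exp (R\<^sup>2)"
  have KA: "A \<le> K" using A by (simp add: K_def)
  have K: "K > 0" using A KA by linarith
  have grad: "norm (G z) \<le> K * exp (- N * \<tau> z)" if "z \<in> \<Omega>" for z
    unfolding K_def
  proof (rule gradient_upper_bound[OF \<Omega> R _ u G \<tau>h _ that])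
    show "A > 0" using A by simp
    show "\<forall>\<^sub>F z in at p within \<Omega>. norm (G z) * exp (N * \<tau> z) < m"
      if "p \<in> frontier \<Omega>" "A < m" for p m
      using that by (intro bd continuous_on_norm cG bound small) auto
  qed
  have bdu: "\<forall>\<^sub>F z in at p within \<Omega>. \<bar>u z\<bar> * exp (N * \<tau> z) < m"
    if "p \<in> frontier \<Omega>" "K < m" for p m
    using that KA by (intro bd continuous_on_rabs cu bound small) auto
  have hess: "\<exists>H. (G has_derivative H) (at z) \<and> (\<Sum>b\<in>Basis. H b \<bullet> b) = 0" if "z \<in> \<Omega>" for z
    using harmonic_on_gradient[OF u \<Omega> G that] by metis
  have "u z \<le> K * exp (R\<^sup>2) * exp (- N * \<tau> z)"
  proof (rule harmonic_upper_bound[OF \<Omega> R K G hess \<tau>h grad _ z])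
    show "\<forall>\<^sub>F z in at p within \<Omega>. u z * exp (N * \<tau> z) < m" if "p \<in> frontier \<Omega>" "K < m" for p m
      using bdu[OF that]
      by eventually_elim (meson abs_ge_self exp_ge_zero le_less_trans mult_right_mono)
  qed
  moreover have "- u z \<le> K * exp (R\<^sup>2) * exp (- N * \<tau> z)"
  proof (rule harmonic_upper_bound[where G = "\<lambda>z. - G z", OF \<Omega> R K _ _ \<tau>h _ _ z])
    show "GDERIV (\<lambda>z. - u z) z :> - G z" if "z \<in> \<Omega>" for z
      using G[OF that] by (rule GDERIV_minus)
    show "\<exists>H. ((\<lambda>z. - G z) has_derivative H) (at z) \<and> (\<Sum>b\<in>Basis. H b \<bullet> b) = 0"
      if z: "z \<in> \<Omega>" for z
    proof -
      obtain H where "(G has_derivative H) (at z)" "(\<Sum>b\<in>Basis. H b \<bullet> b) = 0"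
        using hess[OF z] by blast
      then show ?thesis
        by (intro exI[of _ "\<lambda>v. - H v"]) (simp add: has_derivative_minus sum_negf)
    qed
    show "norm (- G z) \<le> K * exp (- N * \<tau> z)" if "z \<in> \<Omega>" for z
      using grad[OF that] by simp
    show "\<forall>\<^sub>F z in at p within \<Omega>. - u z * exp (N * \<tau> z) < m" if "p \<in> frontier \<Omega>" "K < m" for p m
      using bdu[OF that]
      by eventually_elim (meson abs_ge_minus_self exp_ge_zero le_less_trans mult_right_mono)
  qed
  ultimately have "\<bar>u z\<bar> \<le> K * exp (R\<^sup>2) * exp (- N * \<tau> z)" by linarith
  also have "exp (- N * \<tau> z) = \<epsilon> powr \<tau> z"
    using \<epsilon> by (simp add: powr_def N_def mult.commute)
  also have "K * exp (R\<^sup>2) = A * exp (2 * R\<^sup>2)"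
    by (simp add: K_def mult.assoc flip: exp_add)
  finally show ?thesis .
qed

section \<open>The boundary curve\<close>

locale smooth_boundary =
  fixes \<Omega> :: "complex set"
  assumes smooth: "smooth_simply_connected_domain \<Omega>"
begin

abbreviation "\<gamma> \<equiv> boundary_param \<Omega>"

definition velocity :: "real \<Rightarrow> complex" where
  "velocity t = vector_derivative \<gamma> (at t)"

lemma open_domain: "open \<Omega>" and bounded_domain: "bounded \<Omega>"
  using smooth by (auto simp: smooth_simply_connected_domain_def)

lemma parametrization: "smooth_closed_parametrization \<gamma> (frontier \<Omega>)"
proof -
  have "\<exists>\<gamma>. smooth_closed_parametrization \<gamma> (frontier \<Omega>)"
    using smooth by (simp add: smooth_simply_connected_domain_def)
  then show ?thesis unfolding boundary_param_def by (rule someI_ex)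
qed

lemma param_range: "\<gamma> ` {0..<1} = frontier \<Omega>" and param_inj: "inj_on \<gamma> {0..<1}"
  and param_plus_1: "\<gamma> (t + 1) = \<gamma> t" and velocity_nonzero: "velocity t \<noteq> 0"
  using parametrization by (auto simp: smooth_closed_parametrization_def velocity_def)

lemma param_deriv: "(\<gamma> has_vector_derivative velocity t) (at t)"
  and continuous_velocity: "continuous_on UNIV velocity"
proof -
  from parametrization obtain D where D: "D 0 = \<gamma>"
    "\<And>k t. (D k has_vector_derivative D (Suc k) t) (at t)"
    unfolding smooth_closed_parametrization_def smooth_curve_def by blast
  have "velocity = D (Suc 0)"
    unfolding velocity_def using D(2)[of 0] by (auto simp: D(1) vector_derivative_at fun_eq_iff)
  then show "(\<gamma> has_vector_derivative velocity t) (at t)" using D(2)[of 0] by (simp add: D(1))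
  show "continuous_on UNIV velocity" unfolding \<open>velocity = D (Suc 0)\<close>
    using D(2)[of "Suc 0"]
    by (meson continuous_at_imp_continuous_on has_vector_derivative_continuous)
qed

lemma continuous_param: "continuous_on S \<gamma>"
  using param_deriv by (meson continuous_at_imp_continuous_on has_vector_derivative_continuous)

lemma isCont_velocity: "isCont velocity t"
  using continuous_velocity by (simp add: continuous_on_eq_continuous_at)

lemma param_plus_int: "\<gamma> (t + of_int k) = \<gamma> t"
proof (induction k rule: int_induct[where k = 0])
  case (step1 i)
  then show ?case using param_plus_1[of "t + of_int i"] by (simp add: add.assoc)
next
  case (step2 i)
  then show ?case using param_plus_1[of "t + of_int (i - 1)"] by (simp add: algebra_simps)
qed simp

lemma velocity_plus_int: "velocity (t + of_int k) = velocity t"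
proof -
  have "((\<lambda>s. \<gamma> (s + of_int k)) has_vector_derivative velocity (t + of_int k)) (at t)"
    using vector_diff_chain_at[of "\<lambda>s. s + of_int k" 1 t \<gamma> "velocity (t + of_int k)"] param_deriv
    by (simp add: o_def has_vector_derivative_add_const)
  then have "(\<gamma> has_vector_derivative velocity (t + of_int k)) (at t)"
    by (simp add: param_plus_int)
  then show ?thesis using param_deriv vector_derivative_unique_at by blast
qed

lemma param_frac: "\<gamma> (frac t) = \<gamma> t"
  using param_plus_int[of t "- \<lfloor>t\<rfloor>"] by (simp add: frac_def)

lemma param_in_frontier: "\<gamma> t \<in> frontier \<Omega>"
proof -
  have "\<gamma> (frac t) \<in> \<gamma> ` {0..<1}" by (intro imageI) (simp add: frac_lt_1)
  then show ?thesis by (simp add: param_range param_frac)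
qed

lemma param_eq_imp: "\<gamma> s = \<gamma> t \<Longrightarrow> \<exists>k::int. s = t + of_int k"
proof -
  assume "\<gamma> s = \<gamma> t"
  then have "\<gamma> (frac s) = \<gamma> (frac t)" by (simp add: param_frac)
  then have "frac s = frac t" using param_inj by (auto simp: inj_on_def frac_lt_1)
  then have "s = t + of_int (\<lfloor>s\<rfloor> - \<lfloor>t\<rfloor>)" by (simp add: frac_def algebra_simps)
  then show ?thesis ..
qed

lemma frontier_cases:
  assumes "x \<in> frontier \<Omega>"
  obtains t where "x = \<gamma> t" "a - 1/2 \<le> t" "t \<le> a + 1/2"
proof -
  obtain s where s: "x = \<gamma> s" using assms param_range by blast
  define k where "k = \<lfloor>s - a + 1/2\<rfloor>"
  have "x = \<gamma> (s + of_int (- k))" unfolding s by (rule param_plus_int[symmetric])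
  moreover have "a - 1/2 \<le> s + of_int (- k)" "s + of_int (- k) \<le> a + 1/2"
    unfolding k_def by linarith+
  ultimately show thesis by (rule that)
qed

text \<open>By compactness, \<open>\<gamma> a\<close> has positive distance to the part of the curve whose parameter is at least \<open>d\<close>
  away from \<open>a\<close>, up to periods. So near \<open>\<gamma> a\<close> the boundary consists of one arc only.\<close>

lemma param_local_inverse:
  assumes "d > 0"
  shows "\<exists>r>0. \<forall>x\<in>frontier \<Omega>. dist x (\<gamma> a) < r \<longrightarrow> (\<exists>t. \<bar>t - a\<bar> < d \<and> x = \<gamma> t)"
proof -
  define e where "e = min d (1/2)"
  \<comment> \<open>One period centred at \<open>a\<close>, with a neighbourhood of \<open>a\<close> removed.\<close>
  define K where "K = {a - 1/2..a - e} \<union> {a + e..a + 1/2}"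
  have e: "e > 0" "e \<le> d" "e \<le> 1/2" using assms by (auto simp: e_def)
  have "compact (\<gamma> ` K)"
    unfolding K_def by (intro compact_continuous_image continuous_param compact_Un compact_Icc)
  moreover have "\<gamma> a \<notin> \<gamma> ` K"
  proof
    assume "\<gamma> a \<in> \<gamma> ` K"
    then obtain t where t: "\<gamma> a = \<gamma> t" "t \<in> K" by (rule imageE)
    obtain k :: int where k: "t = a + of_int k" using param_eq_imp[OF t(1)[symmetric]] by blast
    have "\<bar>of_int k :: real\<bar> \<le> 1/2" "of_int k \<noteq> (0::real)"
      using t(2) e unfolding k K_def by auto
    then have "real_of_int \<bar>k\<bar> < 1" "k \<noteq> 0" by auto
    then show False by linarith
  qed
  ultimately have "\<exists>r>0. \<forall>x\<in>\<gamma> ` K. r \<le> dist (\<gamma> a) x"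
    by (intro separate_point_closed compact_imp_closed)
  then obtain r where r: "r > 0" "\<And>t. t \<in> K \<Longrightarrow> r \<le> dist (\<gamma> a) (\<gamma> t)" by auto
  have "\<exists>t. \<bar>t - a\<bar> < d \<and> x = \<gamma> t" if x: "x \<in> frontier \<Omega>" "dist x (\<gamma> a) < r" for x
  proof -
    obtain t where t: "x = \<gamma> t" "a - 1/2 \<le> t" "t \<le> a + 1/2" using x(1) by (rule frontier_cases)
    have "t \<notin> K" using r(2)[of t] x(2) t(1) by (auto simp: dist_commute)
    then have "\<bar>t - a\<bar> < d" using t e by (auto simp: K_def)
    then show ?thesis using t(1) by blast
  qed
  then show ?thesis using r(1) by blast
qed

lemma outer_normal_orthogonal:
  assumes "is_outer_unit_normal \<Omega> (\<gamma> a) \<nu>"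
  shows "\<nu> \<bullet> velocity a = 0"
proof -
  have lim: "((\<lambda>y. \<nu> \<bullet> (y - \<gamma> a) / norm (y - \<gamma> a)) \<longlongrightarrow> 0) (at (\<gamma> a) within frontier \<Omega>)"
    using assms by (simp add: is_outer_unit_normal_def)
  have "\<forall>\<^sub>F t in at_right a. a < t \<and> t < a + 1"
    using eventually_at_right_real[of a "a + 1"] by simp
  then have ne: "\<forall>\<^sub>F t in at_right a. \<gamma> t \<noteq> \<gamma> a \<and> t > a"
  proof eventually_elim
    case (elim t)
    have "\<gamma> t \<noteq> \<gamma> a"
    proof
      assume "\<gamma> t = \<gamma> a"
      then obtain k :: int where "t = a + of_int k" using param_eq_imp by blast
      then have "0 < k \<and> k < 1" using elim by simp
      then show False by linarith
    qed
    then show ?case using elim by simp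
  qed
  have q: "((\<lambda>t. (\<gamma> t - \<gamma> a) /\<^sub>R (t - a)) \<longlongrightarrow> velocity a) (at_right a)"
  proof -
    have "(\<gamma> has_derivative (\<lambda>h. h *\<^sub>R velocity a)) (at_right a)"
      using param_deriv[of a] unfolding has_vector_derivative_def by (rule has_derivative_at_withinI)
    then have "((\<lambda>t. norm (\<gamma> t - \<gamma> a - (t - a) *\<^sub>R velocity a) / norm (t - a)) \<longlongrightarrow> 0) (at_right a)"
      by (simp add: has_derivative_iff_norm)
    moreover have "\<forall>\<^sub>F t in at_right a. norm (\<gamma> t - \<gamma> a - (t - a) *\<^sub>R velocity a) / norm (t - a) =
        norm ((\<gamma> t - \<gamma> a) /\<^sub>R (t - a) - velocity a)"
      using ne
    proof eventually_elim
      case (elim t)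
      then have eq: "(\<gamma> t - \<gamma> a) /\<^sub>R (t - a) - velocity a
          = (\<gamma> t - \<gamma> a - (t - a) *\<^sub>R velocity a) /\<^sub>R (t - a)"
        by (simp add: scaleR_right_diff_distrib)
      show ?case unfolding eq norm_scaleR by (simp add: divide_inverse mult.commute)
    qed
    ultimately have "((\<lambda>t. norm ((\<gamma> t - \<gamma> a) /\<^sub>R (t - a) - velocity a)) \<longlongrightarrow> 0) (at_right a)"
      by (rule Lim_transform_eventually)
    then show ?thesis by (rule LIM_zero_cancel[OF tendsto_norm_zero_cancel])
  qed
  have "filterlim \<gamma> (at (\<gamma> a) within frontier \<Omega>) (at_right a)"
    unfolding filterlim_at
  proof (intro conjI)
    show "\<forall>\<^sub>F t in at_right a. \<gamma> t \<in> frontier \<Omega> \<and> \<gamma> t \<noteq> \<gamma> a"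
      using ne by eventually_elim (simp add: param_in_frontier)
    show "(\<gamma> \<longlongrightarrow> \<gamma> a) (at_right a)"
      using continuous_param[of UNIV] by (auto simp: continuous_on_def intro: tendsto_within_subset)
  qed
  with lim have "((\<lambda>t. \<nu> \<bullet> (\<gamma> t - \<gamma> a) / norm (\<gamma> t - \<gamma> a)) \<longlongrightarrow> 0) (at_right a)"
    by (rule filterlim_compose)
  moreover have "\<forall>\<^sub>F t in at_right a. \<nu> \<bullet> (\<gamma> t - \<gamma> a) / norm (\<gamma> t - \<gamma> a) =
      \<nu> \<bullet> ((\<gamma> t - \<gamma> a) /\<^sub>R (t - a)) / norm ((\<gamma> t - \<gamma> a) /\<^sub>R (t - a))"
    using ne
  proof eventually_elim
    case (elim t)
    define c where "c = inverse (t - a)"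
    have "c > 0" using elim by (simp add: c_def)
    then show ?case unfolding c_def[symmetric] inner_scaleR_right norm_scaleR by simp
  qed
  ultimately have "((\<lambda>t. \<nu> \<bullet> ((\<gamma> t - \<gamma> a) /\<^sub>R (t - a)) / norm ((\<gamma> t - \<gamma> a) /\<^sub>R (t - a))) \<longlongrightarrow> 0) (at_right a)"
    by (rule Lim_transform_eventually)
  moreover have "((\<lambda>t. \<nu> \<bullet> ((\<gamma> t - \<gamma> a) /\<^sub>R (t - a)) / norm ((\<gamma> t - \<gamma> a) /\<^sub>R (t - a))) \<longlongrightarrow>
      \<nu> \<bullet> velocity a / norm (velocity a)) (at_right a)"
    using velocity_nonzero[of a] by (intro tendsto_intros q) simp
  ultimately have "\<nu> \<bullet> velocity a / norm (velocity a) = 0"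
    by (rule tendsto_unique[OF trivial_limit_at_right_real, THEN sym])
  then show ?thesis using velocity_nonzero[of a] by simp
qed

text \<open>A short boundary arc moved inwards along the fixed direction \<open>- \<nu>\<close> lies in \<open>\<Omega>\<close>, with the same bound on
  the shift for the whole arc. The union \<open>T\<close> of the moved arcs is connected and meets \<open>\<Omega>\<close>. It
  does not meet the boundary: near \<open>\<gamma> a\<close> the boundary is a graph over the tangent line, and a shift
  along the normal does not change the coordinate along this line.\<close>

lemma translated_arc_in_domain:
  assumes \<nu>: "is_outer_unit_normal \<Omega> (\<gamma> a) \<nu>"
  shows "\<exists>d>0. \<forall>t s. \<bar>t - a\<bar> < d \<and> 0 < s \<and> s < d \<longrightarrow> \<gamma> t - s *\<^sub>R \<nu> \<in> \<Omega>"
proof -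
  define g where "g t = velocity t \<bullet> velocity a" for t
  have "isCont g a"
    unfolding g_def by (intro continuous_intros isCont_velocity)
  then have "\<forall>\<^sub>F t in nhds a. g t > 0"
    unfolding continuous_at tendsto_at_iff_tendsto_nhds
    by (rule order_tendstoD(1)) (simp add: velocity_nonzero g_def)
  then obtain d1 where d1: "d1 > 0" "\<And>t. \<bar>t - a\<bar> < d1 \<Longrightarrow> velocity t \<bullet> velocity a > 0"
    unfolding eventually_nhds_metric dist_real_def g_def by blast
  \<comment> \<open>The tangential coordinate is a parameter of the arc.\<close>
  have mono: "\<gamma> s \<bullet> velocity a < \<gamma> t \<bullet> velocity a"
    if st: "s < t" "\<bar>s - a\<bar> < d1" "\<bar>t - a\<bar> < d1" for s t
  proof (rule DERIV_pos_imp_increasing[OF st(1)])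
    fix x assume "s \<le> x" "x \<le> t"
    then have "\<bar>x - a\<bar> < d1" using st by auto
    moreover have "((\<lambda>t. \<gamma> t \<bullet> velocity a) has_real_derivative velocity x \<bullet> velocity a) (at x)"
    proof -
      have "(\<gamma> has_derivative (\<lambda>h. h *\<^sub>R velocity x)) (at x)"
        using param_deriv by (simp add: has_vector_derivative_def)
      from has_derivative_inner_left[OF this, of "velocity a"] show ?thesis
        by (simp add: has_field_derivative_def mult.commute[of _ "_ \<bullet> _"])
    qed
    ultimately show "\<exists>y. ((\<lambda>t. \<gamma> t \<bullet> velocity a) has_real_derivative y) (at x) \<and> 0 < y"
      using d1(2) by blast
  qed
  obtain r where r: "r > 0"
    "\<And>x. x \<in> frontier \<Omega> \<Longrightarrow> dist x (\<gamma> a) < r \<Longrightarrow> \<exists>t. \<bar>t - a\<bar> < d1 \<and> x = \<gamma> t"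
    using param_local_inverse[OF d1(1), of a] by blast
  have "isCont \<gamma> a" using continuous_param[of UNIV] by (simp add: continuous_on_eq_continuous_at)
  then obtain d2 where d2: "d2 > 0" "\<And>t. \<bar>t - a\<bar> < d2 \<Longrightarrow> dist (\<gamma> t) (\<gamma> a) < r / 2"
    unfolding continuous_at_eps_delta using r(1) by (metis dist_real_def half_gt_zero)
  from \<nu> obtain d3 where d3: "d3 > 0" "\<And>s. 0 < s \<Longrightarrow> s < d3 \<Longrightarrow> \<gamma> a - s *\<^sub>R \<nu> \<in> \<Omega>"
    and \<nu>1: "norm \<nu> = 1"
    unfolding is_outer_unit_normal_def by blast
  define d where "d = min (min d1 d2) (min d3 (r / 2))"
  have d: "d > 0" "d \<le> d1" "d \<le> d2" "d \<le> d3" "d \<le> r / 2"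
    using d1 d2 d3 r(1) by (auto simp: d_def)
  define T where "T = (\<lambda>(t, s). \<gamma> t - s *\<^sub>R \<nu>) ` ({a - d<..<a + d} \<times> {0<..<d})"
  have "connected T"
    unfolding T_def case_prod_unfold
    by (intro connected_continuous_image connected_Times connected_Ioo continuous_intros
          continuous_on_compose2[OF continuous_param[of UNIV]]) auto
  moreover have "T \<inter> frontier \<Omega> = {}"
  proof (rule ccontr)
    assume "T \<inter> frontier \<Omega> \<noteq> {}"
    then obtain p where p: "p \<in> {a - d<..<a + d} \<times> {0<..<d}"
      "\<gamma> (fst p) - snd p *\<^sub>R \<nu> \<in> frontier \<Omega>"
      unfolding T_def case_prod_unfold by blast
    define t s where "t = fst p" and "s = snd p"
    have fr: "\<gamma> t - s *\<^sub>R \<nu> \<in> frontier \<Omega>" using p(2) by (simp add: t_def s_def)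
    have ts: "\<bar>t - a\<bar> < d" "0 < s" "s < d"
      using p(1) by (auto simp: t_def s_def mem_Times_iff abs_less_iff)
    have "dist (\<gamma> t - s *\<^sub>R \<nu>) (\<gamma> a) \<le> dist (\<gamma> t) (\<gamma> a) + s"
      using norm_triangle_ineq4[of "\<gamma> t - \<gamma> a" "s *\<^sub>R \<nu>"] \<nu>1 ts(2)
      by (simp add: dist_norm algebra_simps)
    also have "\<dots> < r" using d2(2)[of t] ts d by simp
    finally obtain t' where t': "\<bar>t' - a\<bar> < d1" "\<gamma> t - s *\<^sub>R \<nu> = \<gamma> t'"
      using r(2)[OF fr] by blast
    have "\<gamma> t' \<bullet> velocity a = \<gamma> t \<bullet> velocity a"
      unfolding t'(2)[symmetric] using outer_normal_orthogonal[OF \<nu>] by (simp add: inner_diff_left)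
    moreover have "\<bar>t - a\<bar> < d1" using ts d by simp
    ultimately have "t' = t"
      using mono[of t t'] mono[of t' t] t'(1) by (cases t t' rule: linorder_cases) auto
    then show False using t'(2) ts(2) \<nu>1 by auto
  qed
  moreover have "T \<inter> \<Omega> \<noteq> {}"
  proof -
    have "\<gamma> a - (d / 2) *\<^sub>R \<nu> \<in> \<Omega>" using d d3(2)[of "d / 2"] by simp
    moreover have "\<gamma> a - (d / 2) *\<^sub>R \<nu> \<in> T"
      unfolding T_def using d(1) by (intro image_eqI[of _ _ "(a, d / 2)"]) auto
    ultimately show ?thesis by blast
  qed
  ultimately have "T \<subseteq> \<Omega>" using connected_Int_frontier[of T \<Omega>] by blast
  moreover have "\<gamma> t - s *\<^sub>R \<nu> \<in> T" if "\<bar>t - a\<bar> < d" "0 < s" "s < d" for t s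
    unfolding T_def using that by (intro image_eqI[of _ _ "(t, s)"]) (auto simp: abs_less_iff)
  ultimately show ?thesis using d(1) by blast
qed

section \<open>Boundary values and the unit tangent\<close>

text \<open>In \<open>\<Omega>\<close> the chain rule holds along the curves \<open>\<gamma> t - s *\<^sub>R \<nu>\<close>. It is passed to the limit \<open>s \<longlongrightarrow> 0\<close> in the form
  of a difference quotient bound that is uniform in \<open>s\<close>, which continuity of \<open>G\<close> up to the boundary provides.\<close>

lemma trace_has_derivative:
  assumes C1: "C1_closure_with_gradient \<Omega> u G" and \<nu>: "is_outer_unit_normal \<Omega> (\<gamma> a) \<nu>"
  shows "((\<lambda>t. u (\<gamma> t)) has_real_derivative G (\<gamma> a) \<bullet> velocity a) (at a)"
proof -
  define c where "c = G (\<gamma> a) \<bullet> velocity a"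
  have cu: "continuous_on (closure \<Omega>) u" and cG: "continuous_on (closure \<Omega>) G"
    and G: "\<And>x. x \<in> \<Omega> \<Longrightarrow> GDERIV u x :> G x"
    using C1 by (auto simp: C1_closure_with_gradient_def)
  have cl: "\<gamma> t \<in> closure \<Omega>" for t using param_in_frontier[of t] by (simp add: frontier_def)
  obtain d0 where d0: "d0 > 0"
    "\<And>t s. \<bar>t - a\<bar> < d0 \<Longrightarrow> 0 < s \<Longrightarrow> s < d0 \<Longrightarrow> \<gamma> t - s *\<^sub>R \<nu> \<in> \<Omega>"
    using translated_arc_in_domain[OF \<nu>] by blast
  have \<nu>1: "norm \<nu> = 1" using \<nu> by (simp add: is_outer_unit_normal_def)
  have "\<exists>d>0. \<forall>t. norm (t - a) < d \<longrightarrow>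
      norm (u (\<gamma> t) - u (\<gamma> a) - (t - a) * c) \<le> e * norm (t - a)" if e: "e > 0" for e
  proof -
    have "continuous_on (closure \<Omega> \<times> UNIV) (\<lambda>(p, t). G p \<bullet> velocity t)"
      unfolding case_prod_unfold
      by (intro continuous_intros continuous_on_compose2[OF cG]
            continuous_on_compose2[OF continuous_velocity]) auto
    then obtain \<eta> where \<eta>: "\<eta> > 0"
      "\<And>p t. p \<in> closure \<Omega> \<Longrightarrow> dist (p, t) (\<gamma> a, a) < \<eta> \<Longrightarrow> dist (G p \<bullet> velocity t) c < e"
      unfolding continuous_on_iff c_def using e cl[of a] by fastforce
    have near: "\<bar>G p \<bullet> velocity t - c\<bar> \<le> e"
      if "p \<in> closure \<Omega>" "dist p (\<gamma> a) < \<eta> / 2" "\<bar>t - a\<bar> < \<eta> / 2" for p t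
    proof -
      have "dist (p, t) (\<gamma> a, a) \<le> dist (p, t) (\<gamma> a, t) + dist (\<gamma> a, t) (\<gamma> a, a)"
        by (rule dist_triangle)
      also have "\<dots> < \<eta>" using that by (simp add: dist_Pair_Pair dist_real_def)
      finally show ?thesis using \<eta>(2)[OF that(1)] by (simp add: dist_real_def less_imp_le)
    qed
    have "isCont \<gamma> a" using continuous_param[of UNIV] by (simp add: continuous_on_eq_continuous_at)
    then obtain d1 where d1: "d1 > 0" "\<And>t. \<bar>t - a\<bar> < d1 \<Longrightarrow> dist (\<gamma> t) (\<gamma> a) < \<eta> / 4"
      unfolding continuous_at_eps_delta using \<eta>(1) by (metis dist_real_def zero_less_divide_iff zero_less_numeral)
    define d where "d = min (min d0 d1) (\<eta> / 4)"
    have d: "d > 0" "d \<le> d0" "d \<le> d1" "d \<le> \<eta> / 4" using d0 d1 \<eta> by (auto simp: d_def)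
    have shifted: "\<bar>u (\<gamma> t - s *\<^sub>R \<nu>) - u (\<gamma> a - s *\<^sub>R \<nu>) - (t - a) * c\<bar> \<le> e * \<bar>t - a\<bar>"
      if t: "\<bar>t - a\<bar> < d" and s: "0 < s" "s < d" for t s
    proof -
      define \<phi> where "\<phi> t = u (\<gamma> t - s *\<^sub>R \<nu>) - t * c" for t
      have "norm (\<phi> t - \<phi> a) \<le> e * norm (t - a)"
      proof (rule field_differentiable_bound[where S = "ball a d"])
        show "t \<in> ball a d" "a \<in> ball a d" using t d by (auto simp: dist_real_def)
        fix x assume "x \<in> ball a d"
        then have x: "\<bar>x - a\<bar> < d" by (simp add: dist_real_def abs_minus_commute)
        define p where "p = \<gamma> x - s *\<^sub>R \<nu>"
        have p: "p \<in> \<Omega>" unfolding p_def using d0(2)[of x s] x s d by simp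
        have "(u has_derivative (\<lambda>h. h \<bullet> G p)) (at p)" using G[OF p] by (simp add: gderiv_def)
        moreover have "((\<lambda>x. \<gamma> x - s *\<^sub>R \<nu>) has_derivative (\<lambda>h. h *\<^sub>R velocity x)) (at x)"
          using param_deriv[of x] unfolding has_vector_derivative_def
          by (auto intro!: derivative_eq_intros)
        ultimately have "((\<lambda>x. u (\<gamma> x - s *\<^sub>R \<nu>)) has_derivative (\<lambda>h. (h *\<^sub>R velocity x) \<bullet> G p)) (at x)"
          unfolding p_def using has_derivative_compose by blast
        then have "((\<lambda>x. u (\<gamma> x - s *\<^sub>R \<nu>)) has_real_derivative G p \<bullet> velocity x) (at x)"
          unfolding has_field_derivative_def by (simp add: inner_commute mult.commute[of _ "_ \<bullet> _"])
        then have "(\<phi> has_real_derivative (G p \<bullet> velocity x - c)) (at x)"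
          unfolding \<phi>_def by (auto intro!: derivative_eq_intros)
        then show "(\<phi> has_real_derivative (G (\<gamma> x - s *\<^sub>R \<nu>) \<bullet> velocity x - c)) (at x within ball a d)"
          unfolding p_def by (rule has_field_derivative_at_within)
        have "dist p (\<gamma> a) \<le> dist (\<gamma> x) (\<gamma> a) + s"
          using norm_triangle_ineq4[of "\<gamma> x - \<gamma> a" "s *\<^sub>R \<nu>"] \<nu>1 s
          by (simp add: p_def dist_norm algebra_simps)
        also have "\<dots> < \<eta> / 2" using d1(2)[of x] x s d by simp
        finally have "\<bar>G p \<bullet> velocity x - c\<bar> \<le> e"
          using p closure_subset x d \<eta>(1) by (intro near) auto
        then show "norm (G (\<gamma> x - s *\<^sub>R \<nu>) \<bullet> velocity x - c) \<le> e" by (simp add: p_def)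
      qed simp
      then show ?thesis by (simp add: \<phi>_def algebra_simps)
    qed
    have "\<bar>u (\<gamma> t) - u (\<gamma> a) - (t - a) * c\<bar> \<le> e * \<bar>t - a\<bar>" if t: "\<bar>t - a\<bar> < d" for t
    proof -
      have lim: "((\<lambda>s. u (\<gamma> x - s *\<^sub>R \<nu>)) \<longlongrightarrow> u (\<gamma> x)) (at_right 0)" if x: "\<bar>x - a\<bar> < d" for x
      proof (rule continuous_on_tendsto_compose[OF cu _ cl])
        have "((\<lambda>s. \<gamma> x - s *\<^sub>R \<nu>) \<longlongrightarrow> \<gamma> x - 0 *\<^sub>R \<nu>) (at_right 0)"
          by (intro tendsto_intros)
        then show "((\<lambda>s. \<gamma> x - s *\<^sub>R \<nu>) \<longlongrightarrow> \<gamma> x) (at_right 0)" by simp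
        have "\<forall>\<^sub>F s in at_right 0. s \<in> {0<..<d}" using d(1) by (rule eventually_at_right_real)
        then show "\<forall>\<^sub>F s in at_right 0. \<gamma> x - s *\<^sub>R \<nu> \<in> closure \<Omega>"
        proof eventually_elim
          case (elim s)
          have "\<gamma> x - s *\<^sub>R \<nu> \<in> \<Omega>" using d0(2)[of x s] x elim d by simp
          then show ?case using closure_subset by blast
        qed
      qed
      have "((\<lambda>s. \<bar>u (\<gamma> t - s *\<^sub>R \<nu>) - u (\<gamma> a - s *\<^sub>R \<nu>) - (t - a) * c\<bar>) \<longlongrightarrow>
          \<bar>u (\<gamma> t) - u (\<gamma> a) - (t - a) * c\<bar>) (at_right 0)"
        using t d(1) by (intro tendsto_intros lim) auto
      moreover have "\<forall>\<^sub>F s in at_right 0. s \<in> {0<..<d}" using d(1) by (rule eventually_at_right_real)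
      then have "\<forall>\<^sub>F s in at_right 0. \<bar>u (\<gamma> t - s *\<^sub>R \<nu>) - u (\<gamma> a - s *\<^sub>R \<nu>) - (t - a) * c\<bar> \<le> e * \<bar>t - a\<bar>"
        by eventually_elim (use shifted[OF t] in auto)
      ultimately show ?thesis
        using tendsto_upperbound trivial_limit_at_right_real by blast
    qed
    then show ?thesis using d(1) by (intro exI[of _ d]) auto
  qed
  then have "((\<lambda>t. u (\<gamma> t)) has_derivative (\<lambda>h. h * c)) (at a)"
    unfolding has_derivative_at_alt by (auto intro: bounded_linear_mult_left)
  then show ?thesis by (simp add: has_field_derivative_def c_def mult.commute[of _ "_ \<bullet> _"])
qed

text \<open>Choosing another parameter of the same point changes it by a period only, which leaves the velocity
  unchanged.\<close>

definition unit_tangent :: "complex \<Rightarrow> complex" where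
  "unit_tangent x = sgn (velocity (SOME t. \<gamma> t = x))"

lemma unit_tangent_param: "unit_tangent (\<gamma> t) = sgn (velocity t)"
proof -
  have "\<gamma> (SOME s. \<gamma> s = \<gamma> t) = \<gamma> t" by (rule someI) simp
  then obtain k :: int where "(SOME s. \<gamma> s = \<gamma> t) = t + of_int k" using param_eq_imp by blast
  then show ?thesis by (simp add: unit_tangent_def velocity_plus_int)
qed

lemma norm_unit_tangent: "x \<in> frontier \<Omega> \<Longrightarrow> norm (unit_tangent x) = 1"
  using param_range velocity_nonzero by (metis imageE norm_sgn unit_tangent_param)

lemma velocity_eq: "velocity t = norm (velocity t) *\<^sub>R unit_tangent (\<gamma> t)"
  by (simp add: unit_tangent_param sgn_div_norm velocity_nonzero)

text \<open>A period of \<open>\<gamma>\<close> is a continuous map from a compact interval onto the boundary, hence a quotient map.\<close>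

lemma continuous_on_frontierI:
  fixes h :: "complex \<Rightarrow> 'b::topological_space"
  assumes "continuous_on UNIV (\<lambda>t. h (\<gamma> t))"
  shows "continuous_on (frontier \<Omega>) h"
proof -
  have im: "\<gamma> ` {0..1} = frontier \<Omega>"
  proof
    show "\<gamma> ` {0..1} \<subseteq> frontier \<Omega>" using param_in_frontier by blast
    show "frontier \<Omega> \<subseteq> \<gamma> ` {0..1}" unfolding param_range[symmetric] by (intro image_mono) auto
  qed
  have "openin (top_of_set (frontier \<Omega>)) (frontier \<Omega> \<inter> h -` U)" if U: "open U" for U
  proof -
    have "continuous_on {0..1} (\<lambda>t. h (\<gamma> t))"
      using assms by (rule continuous_on_subset) simp
    then have "openin (top_of_set {0..1}) ({0..1} \<inter> (\<lambda>t. h (\<gamma> t)) -` U)"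
      using U by (simp add: continuous_openin_preimage_eq)
    moreover have "{0..1} \<inter> (\<lambda>t. h (\<gamma> t)) -` U = {0..1} \<inter> \<gamma> -` (frontier \<Omega> \<inter> h -` U)"
      using param_in_frontier by auto
    ultimately have "openin (top_of_set {0..1}) ({0..1} \<inter> \<gamma> -` (frontier \<Omega> \<inter> h -` U))"
      by (simp only:)
    then show ?thesis
      by (rule iffD1[OF Abstract_Topology_2.continuous_imp_quotient_map[OF continuous_param im compact_Icc], rotated]) simp
  qed
  then show ?thesis
    by (simp add: continuous_openin_preimage_eq)
qed

lemma continuous_unit_tangent: "continuous_on (frontier \<Omega>) unit_tangent"
proof (rule continuous_on_frontierI)
  show "continuous_on UNIV (\<lambda>t. unit_tangent (\<gamma> t))"
    unfolding unit_tangent_param sgn_div_norm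
    using velocity_nonzero by (intro continuous_intros continuous_velocity) auto
qed

section \<open>Arc length and essential suprema\<close>

abbreviation "\<mu> \<equiv> arclength_measure \<Omega>"

lemma sets_arclength [simp, measurable_cong]: "sets \<mu> = sets borel"
  and space_arclength [simp]: "space \<mu> = UNIV"
  by (auto simp: arclength_measure_def)

lemma boundary_speed_eq: "boundary_speed \<Omega> t = norm (velocity t)"
  by (simp add: boundary_speed_def velocity_def)

lemma measurable_param [measurable]: "\<gamma> \<in> borel_measurable borel"
  by (rule borel_measurable_continuous_onI) (rule continuous_param)

lemma measurable_velocity [measurable]: "velocity \<in> borel_measurable borel"
  by (rule borel_measurable_continuous_onI) (rule continuous_velocity)

lemma integral_arclength:
  fixes h :: "complex \<Rightarrow> real"
  assumes [measurable]: "h \<in> borel_measurable borel"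
  shows "integral\<^sup>L \<mu> h = (LINT t:{0..<1}|lborel. norm (velocity t) * h (\<gamma> t))"
proof -
  let ?R = "restrict_space lborel {0..<1::real}"
  have m1 [measurable]: "\<gamma> \<in> borel_measurable ?R" and m2 [measurable]: "velocity \<in> borel_measurable ?R"
    by (auto intro!: measurable_restrict_space1)
  have "integral\<^sup>L \<mu> h = (LINT t|density ?R (\<lambda>t. ennreal (norm (velocity t))). h (\<gamma> t))"
    unfolding arclength_measure_def boundary_speed_eq by (rule integral_distr) auto
  also have "\<dots> = (LINT t|?R. norm (velocity t) *\<^sub>R h (\<gamma> t))"
    by (rule integral_density) auto
  also have "\<dots> = (LINT t:{0..<1}|lborel. norm (velocity t) * h (\<gamma> t))"
    by (subst integral_restrict_space) (auto simp: set_lebesgue_integral_def)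
  finally show ?thesis .
qed

lemma finite_arclength: "finite_measure \<mu>"
proof (rule finite_measureI)
  let ?R = "restrict_space lborel {0..<1::real}"
  have m1 [measurable]: "\<gamma> \<in> borel_measurable ?R" and m2 [measurable]: "velocity \<in> borel_measurable ?R"
    by (auto intro!: measurable_restrict_space1)
  have "bounded (velocity ` {0..1})"
    by (intro compact_imp_bounded compact_continuous_image
          continuous_on_subset[OF continuous_velocity]) auto
  then obtain B where "\<forall>x\<in>velocity ` {0..1}. norm x \<le> B"
    unfolding bounded_iff by blast
  then have B: "norm (velocity t) \<le> B" if "t \<in> {0..1}" for t using that by blast
  have "emeasure \<mu> UNIV = emeasure (density ?R (\<lambda>t. ennreal (norm (velocity t)))) (space ?R)"
    unfolding arclength_measure_def boundary_speed_eq by (subst emeasure_distr) auto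
  also have "\<dots> = (\<integral>\<^sup>+t. ennreal (norm (velocity t)) * indicator (space ?R) t \<partial>?R)"
    by (rule emeasure_density[OF _ sets.top]) measurable
  also have "\<dots> = (\<integral>\<^sup>+t. ennreal (norm (velocity t)) \<partial>?R)"
    by (rule nn_integral_cong) simp
  also have "\<dots> \<le> (\<integral>\<^sup>+t. ennreal B \<partial>?R)"
    using B by (intro nn_integral_mono ennreal_leI) (auto simp: space_restrict_space)
  also have "\<dots> = ennreal B * emeasure ?R {0..<1}"
    by (simp add: space_restrict_space)
  also have "\<dots> = ennreal B" by (subst emeasure_restrict_space) auto
  also have "\<dots> < \<infinity>" by simp
  finally show "emeasure \<mu> (space \<mu>) \<noteq> \<infinity>" by simp
qed

text \<open>Such a set contains the image of an interval of parameters, on which the speed is positive.\<close>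

lemma arclength_pos:
  assumes V: "openin (top_of_set (frontier \<Omega>)) V" and x: "x \<in> V"
  shows "V \<notin> null_sets \<mu>"
proof
  let ?R = "restrict_space lborel {0..<1::real}"
  let ?D = "density ?R (\<lambda>t. ennreal (norm (velocity t)))"
  have m1 [measurable]: "\<gamma> \<in> borel_measurable ?R" and m2 [measurable]: "velocity \<in> borel_measurable ?R"
    by (auto intro!: measurable_restrict_space1)
  assume null: "V \<in> null_sets \<mu>"
  then have [measurable]: "V \<in> sets borel" by (auto simp: null_sets_def)
  obtain W where W: "open W" "V = frontier \<Omega> \<inter> W" using V by (auto simp: openin_open)
  obtain t0 where t0: "t0 \<in> {0..<1}" "x = \<gamma> t0" using x W(2) param_range by blast
  have "open (\<gamma> -` W)" using W(1) continuous_param[of UNIV] by (simp add: open_vimage)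
  moreover have "t0 \<in> \<gamma> -` W" using x W(2) t0(2) by simp
  ultimately obtain d where d: "d > 0" "ball t0 d \<subseteq> \<gamma> -` W" by (meson open_contains_ball)
  \<comment> \<open>The parameter \<open>t0\<close> may be the left end point of the period, so the interval is taken to its right.\<close>
  define b where "b = min (t0 + d) 1"
  have b: "t0 < b" "b \<le> 1" using t0 d by (auto simp: b_def)
  have inV: "\<gamma> t \<in> V \<and> t \<in> {0..<1}" if "t \<in> {t0<..<b}" for t
  proof -
    have "t \<in> ball t0 d" using that by (auto simp: b_def dist_real_def)
    then show ?thesis using d(2) W(2) param_in_frontier that t0 b by auto
  qed
  have "emeasure ?D (\<gamma> -` V \<inter> {0..<1}) = 0"
    using null unfolding arclength_measure_def boundary_speed_eq null_sets_def
    by (auto simp: emeasure_distr space_restrict_space)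
  then have "\<gamma> -` V \<inter> {0..<1} \<in> null_sets ?D"
    by (auto simp: null_sets_def sets_restrict_space)
  then have "AE t in ?R. t \<in> \<gamma> -` V \<inter> {0..<1} \<longrightarrow> ennreal (norm (velocity t)) = 0"
    by (subst (asm) null_sets_density_iff) auto
  then have "AE t in lborel. t \<in> {0..<1} \<longrightarrow> t \<in> \<gamma> -` V \<inter> {0..<1} \<longrightarrow> ennreal (norm (velocity t)) = 0"
    by (subst (asm) AE_restrict_space_iff) auto
  then have "AE t in lborel. t \<notin> {t0<..<b}"
  proof eventually_elim
    case (elim t)
    then show ?case using inV[of t] velocity_nonzero[of t] by (auto simp: ennreal_eq_0_iff)
  qed
  then have "emeasure lborel {t0<..<b} = 0"
    by (subst (asm) AE_iff_measurable[of "{t0<..<b}"]) auto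
  then show False using b by simp
qed

lemma openin_frontier_borel: "openin (top_of_set (frontier \<Omega>)) U \<Longrightarrow> U \<in> sets borel"
  by (auto simp: openin_open)

lemma AE_restrict_continuous_le:
  fixes c :: "complex \<Rightarrow> real"
  assumes \<Gamma>: "openin (top_of_set (frontier \<Omega>)) \<Gamma>" and c: "continuous_on \<Gamma> c"
    and AE: "AE x in restrict_space \<mu> \<Gamma>. c x \<le> B" and x: "x \<in> \<Gamma>"
  shows "c x \<le> B"
proof (rule ccontr)
  assume "\<not> c x \<le> B"
  define V where "V = \<Gamma> \<inter> c -` {B<..}"
  have "openin (top_of_set \<Gamma>) V"
    unfolding V_def using c by (simp add: continuous_openin_preimage_eq)
  then have V: "openin (top_of_set (frontier \<Omega>)) V" using \<Gamma> by (rule openin_trans)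
  have "AE x in \<mu>. x \<in> \<Gamma> \<longrightarrow> c x \<le> B"
    using AE openin_frontier_borel[OF \<Gamma>] by (simp add: AE_restrict_space_iff)
  then have "AE x in \<mu>. x \<notin> V" by eventually_elim (auto simp: V_def)
  then have "V \<in> null_sets \<mu>" using openin_frontier_borel[OF V] by (subst AE_iff_null_sets) auto
  moreover have "x \<in> V" using x \<open>\<not> c x \<le> B\<close> by (simp add: V_def)
  ultimately show False using arclength_pos[OF V] by blast
qed

text \<open>A function with finite essential supremum norm is measurable, because the essential supremum of a
  nonmeasurable function is infinite; and the norm is not \<open>- \<infinity>\<close>, because \<open>\<Gamma>\<close> has positive length.\<close>

lemma Linf_norm_AE_bound:
  assumes \<Gamma>: "openin (top_of_set (frontier \<Omega>)) \<Gamma>" "\<Gamma> \<noteq> {}" and fin: "Linf_enorm \<Omega> \<Gamma> k < \<infinity>"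
  shows "AE x in restrict_space \<mu> \<Gamma>. \<bar>k x\<bar> \<le> Linf_norm \<Omega> \<Gamma> k" and "Linf_norm \<Omega> \<Gamma> k \<ge> 0"
proof -
  let ?M = "restrict_space \<mu> \<Gamma>"
  have AE: "AE x in ?M. ereal \<bar>k x\<bar> \<le> Linf_enorm \<Omega> \<Gamma> k"
    unfolding Linf_enorm_def by (rule esssup_AE)
  have ge: "Linf_enorm \<Omega> \<Gamma> k \<ge> 0"
  proof (rule ccontr)
    assume "\<not> ?thesis"
    then have "AE x in ?M. False"
      using AE by (elim eventually_mono) (metis abs_ge_zero ereal_less_eq(5) order_trans)
    then have "AE x in ?M. (0::real) \<le> -1" by (elim eventually_mono) simp
    then show False
      using AE_restrict_continuous_le[OF \<Gamma>(1), of "\<lambda>_. 0" "-1"] \<Gamma>(2) by auto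
  qed
  have eq: "Linf_enorm \<Omega> \<Gamma> k = ereal (Linf_norm \<Omega> \<Gamma> k)"
    unfolding Linf_norm_def using fin ge by (cases "Linf_enorm \<Omega> \<Gamma> k") auto
  show "AE x in ?M. \<bar>k x\<bar> \<le> Linf_norm \<Omega> \<Gamma> k" using AE unfolding eq by simp
  show "Linf_norm \<Omega> \<Gamma> k \<ge> 0" using ge unfolding eq by simp
qed

lemma restrict_measurable:
  fixes c :: "complex \<Rightarrow> 'b::topological_space"
  assumes "continuous_on \<Gamma> c"
  shows "c \<in> borel_measurable (restrict_space \<mu> \<Gamma>)"
  using borel_measurable_continuous_on_restrict[OF assms]
  by (simp add: measurable_cong_sets[OF sets_restrict_space_cong[OF sets_arclength] refl])

lemma Linf_enorm_finite:
  fixes c k :: "complex \<Rightarrow> real"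
  assumes c: "continuous_on \<Gamma> c" and eq: "\<And>x. x \<in> \<Gamma> \<Longrightarrow> \<bar>k x\<bar> = c x"
    and B: "\<And>x. x \<in> \<Gamma> \<Longrightarrow> c x \<le> B"
  shows "Linf_enorm \<Omega> \<Gamma> k < \<infinity>"
proof -
  let ?M = "restrict_space \<mu> \<Gamma>"
  have sp: "space ?M = \<Gamma>" by (simp add: space_restrict_space)
  have "(\<lambda>x. ereal (c x)) \<in> borel_measurable ?M"
    using restrict_measurable[OF c] by measurable
  then have "(\<lambda>x. ereal \<bar>k x\<bar>) \<in> borel_measurable ?M"
    by (subst measurable_cong[of _ _ "\<lambda>x. ereal (c x)"]) (auto simp: sp eq)
  then have "Linf_enorm \<Omega> \<Gamma> k \<le> ereal B"
    unfolding Linf_enorm_def by (rule esssup_I) (auto simp: sp eq B intro!: AE_I2)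
  then show ?thesis by (rule order.strict_trans1) simp
qed

lemma continuous_le_Linf_norm:
  fixes c k :: "complex \<Rightarrow> real"
  assumes \<Gamma>: "openin (top_of_set (frontier \<Omega>)) \<Gamma>" and c: "continuous_on \<Gamma> c"
    and eq: "\<And>x. x \<in> \<Gamma> \<Longrightarrow> \<bar>k x\<bar> = c x" and B: "\<And>x. x \<in> \<Gamma> \<Longrightarrow> c x \<le> B" and x: "x \<in> \<Gamma>"
  shows "\<bar>k x\<bar> \<le> Linf_norm \<Omega> \<Gamma> k"
proof -
  have ne: "\<Gamma> \<noteq> {}" using x by blast
  have "AE x in restrict_space \<mu> \<Gamma>. \<bar>k x\<bar> \<le> Linf_norm \<Omega> \<Gamma> k"
    by (rule Linf_norm_AE_bound(1)[OF \<Gamma> ne Linf_enorm_finite[OF c eq B]])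
  then have "AE x in restrict_space \<mu> \<Gamma>. c x \<le> Linf_norm \<Omega> \<Gamma> k"
    by (rule AE_mp) (auto intro!: AE_I2 simp: space_restrict_space eq)
  from AE_restrict_continuous_le[OF \<Gamma> c this x] show ?thesis by (simp add: eq x)
qed

section \<open>Weak tangential derivatives\<close>

lemma tangential_derivative_param:
  assumes "tangential_derivative \<Omega> \<phi> \<psi>"
  shows "((\<lambda>t. \<phi> (\<gamma> t)) has_real_derivative \<psi> (\<gamma> t) * norm (velocity t)) (at t)"
  using assms by (simp add: tangential_derivative_def boundary_speed_eq)

text \<open>Near such a point \<open>\<phi>\<close> vanishes along the boundary, and so does its derivative; this makes integrals over
  \<open>\<Gamma>\<close> against \<open>\<psi>\<close> integrals over the whole boundary.\<close>

lemma tangential_derivative_supported: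
  assumes td: "tangential_derivative \<Omega> \<phi> \<psi>" and x: "x \<in> frontier \<Omega>"
    and supp: "x \<notin> closure {x \<in> frontier \<Omega>. \<phi> x \<noteq> 0}"
  shows "\<phi> x = 0" "\<psi> x = 0"
proof -
  let ?S = "closure {x \<in> frontier \<Omega>. \<phi> x \<noteq> 0}"
  have zero: "\<phi> y = 0" if "y \<in> frontier \<Omega>" "y \<notin> ?S" for y
    using that closure_subset[of "{x \<in> frontier \<Omega>. \<phi> x \<noteq> 0}"] by blast
  then show "\<phi> x = 0" using x supp by blast
  obtain t where t: "x = \<gamma> t" using x param_range by blast
  have "open (\<gamma> -` (- ?S))"
    using continuous_param[of UNIV] by (intro open_vimage) auto
  then have "\<forall>\<^sub>F s in nhds t. s \<in> \<gamma> -` (- ?S)"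
    using supp t by (intro eventually_nhds_in_open) auto
  then have "\<forall>\<^sub>F s in nhds t. \<phi> (\<gamma> s) = 0"
    by eventually_elim (simp add: zero param_in_frontier)
  then have "((\<lambda>t. \<phi> (\<gamma> t)) has_real_derivative 0) (at t) \<longleftrightarrow> ((\<lambda>t. 0) has_real_derivative 0) (at t)"
    by (intro DERIV_cong_ev) auto
  then have "((\<lambda>t. \<phi> (\<gamma> t)) has_real_derivative 0) (at t)" by simp
  with tangential_derivative_param[OF td, of t] have "\<psi> (\<gamma> t) * norm (velocity t) = 0"
    by (rule DERIV_unique)
  then show "\<psi> x = 0" using velocity_nonzero[of t] t by simp
qed

lemma integrable_arclength_continuous:
  fixes h :: "complex \<Rightarrow> real"
  assumes h: "continuous_on (frontier \<Omega>) h" and \<Gamma>: "openin (top_of_set (frontier \<Omega>)) \<Gamma>"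
  shows "set_integrable \<mu> \<Gamma> h"
proof -
  interpret finite_measure \<mu> by (rule finite_arclength)
  have sub: "\<Gamma> \<subseteq> frontier \<Omega>" using \<Gamma> by (rule openin_imp_subset)
  have "compact (frontier \<Omega>)" using bounded_domain by (simp add: compact_frontier_bounded)
  then have "bounded (h ` frontier \<Omega>)"
    using h by (intro compact_imp_bounded compact_continuous_image)
  then obtain B where B: "\<And>x. x \<in> frontier \<Omega> \<Longrightarrow> \<bar>h x\<bar> \<le> B" by (auto simp: bounded_iff)
  have "(\<lambda>x. indicator \<Gamma> x *\<^sub>R h x) \<in> borel_measurable borel"
    using openin_frontier_borel[OF \<Gamma>] continuous_on_subset[OF h sub]
    by (rule borel_measurable_continuous_on_indicator)
  then have "(\<lambda>x. indicator \<Gamma> x *\<^sub>R h x) \<in> borel_measurable \<mu>"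
    by (simp add: measurable_cong_sets[OF sets_arclength refl])
  then show ?thesis unfolding set_integrable_def
    by (rule integrable_const_bound[of _ "\<bar>B\<bar>", rotated])
       (use B sub in \<open>force simp: indicator_def intro!: AE_I2\<close>)
qed

text \<open>As \<open>\<phi>\<close> and \<open>\<psi>\<close> vanish on the boundary outside \<open>\<Gamma>\<close>, the integral over \<open>\<Gamma>\<close> extends to the whole
  closed curve, where \<open>u * \<phi>\<close> has the same value at both ends of a period.\<close>

lemma integral_by_parts_arclength:
  assumes \<Gamma>: "openin (top_of_set (frontier \<Omega>)) \<Gamma>"
    and u: "continuous_on (frontier \<Omega>) u" and w: "continuous_on (frontier \<Omega>) w"
    and uw: "tangential_derivative \<Omega> u w"
    and td: "tangential_derivative \<Omega> \<phi> \<psi>" and \<psi>: "continuous_on (frontier \<Omega>) \<psi>"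
    and supp: "closure {x \<in> frontier \<Omega>. \<phi> x \<noteq> 0} \<subseteq> \<Gamma>"
  shows "(LINT x:\<Gamma>|\<mu>. u x * \<psi> x) = - (LINT x:\<Gamma>|\<mu>. w x * \<phi> x)"
proof -
  have cpar: "continuous_on UNIV (\<lambda>t. h (\<gamma> t))" if "continuous_on (frontier \<Omega>) h" for h :: "complex \<Rightarrow> real"
    using continuous_on_compose2[OF that continuous_param] param_in_frontier by blast
  have \<phi>: "continuous_on (frontier \<Omega>) \<phi>"
    using tangential_derivative_param[OF td]
    by (intro continuous_on_frontierI) (meson DERIV_isCont continuous_at_imp_continuous_on)
  define h where "h x = u x * \<psi> x + w x * \<phi> x" for x
  have ch: "continuous_on (frontier \<Omega>) h" unfolding h_def by (intro continuous_intros u w \<psi> \<phi>)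
  have zero: "h x = 0" if "x \<in> frontier \<Omega>" "x \<notin> \<Gamma>" for x
  proof -
    have "x \<notin> closure {x \<in> frontier \<Omega>. \<phi> x \<noteq> 0}" using that(2) supp by blast
    then show ?thesis using tangential_derivative_supported[OF td that(1)] by (simp add: h_def)
  qed
  have sub: "\<Gamma> \<subseteq> frontier \<Omega>" using \<Gamma> by (rule openin_imp_subset)
  define F where "F t = u (\<gamma> t) * \<phi> (\<gamma> t)" for t
  define f where "f t = norm (velocity t) * h (\<gamma> t)" for t
  have F: "(F has_real_derivative f t) (at t)" for t
    unfolding F_def f_def h_def
    by (rule derivative_eq_intros tangential_derivative_param[OF uw] tangential_derivative_param[OF td]
          | simp add: algebra_simps)+
  have cf: "continuous_on UNIV f"
    unfolding f_def by (intro continuous_intros continuous_velocity cpar ch)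
  have "(LINT x:\<Gamma>|\<mu>. u x * \<psi> x) + (LINT x:\<Gamma>|\<mu>. w x * \<phi> x) = (LINT x:\<Gamma>|\<mu>. h x)"
    unfolding h_def
    by (rule set_integral_add(2)[symmetric])
       (intro integrable_arclength_continuous[OF _ \<Gamma>] continuous_intros u w \<psi> \<phi>)+
  also have "\<dots> = (LINT x|\<mu>. indicator \<Gamma> x *\<^sub>R h x)" by (simp add: set_lebesgue_integral_def)
  also have "\<dots> = (LINT t:{0..<1}|lborel. norm (velocity t) * (indicator \<Gamma> (\<gamma> t) *\<^sub>R h (\<gamma> t)))"
    using openin_frontier_borel[OF \<Gamma>] continuous_on_subset[OF ch sub]
    by (intro integral_arclength borel_measurable_continuous_on_indicator)
  also have "\<dots> = (LINT t:{0..<1}|lborel. f t)"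
    using zero param_in_frontier
    by (intro set_lebesgue_integral_cong) (auto simp: f_def indicator_def)
  also have "\<dots> = (LINT t:{0..1}|lborel. f t)"
    unfolding set_lebesgue_integral_def
  proof (rule integral_cong_AE)
    have [measurable]: "f \<in> borel_measurable borel" by (rule borel_measurable_continuous_onI[OF cf])
    show "(\<lambda>t. indicator {0..<1} t *\<^sub>R f t) \<in> borel_measurable lborel"
      "(\<lambda>t. indicator {0..1} t *\<^sub>R f t) \<in> borel_measurable lborel"
      by measurable
    show "AE t in lborel. indicator {0..<1} t *\<^sub>R f t = indicator {0..1} t *\<^sub>R f t"
      using AE_lborel_singleton[of 1] by eventually_elim (auto simp: indicator_def)
  qed
  also have "\<dots> = F 1 - F 0"
    unfolding set_lebesgue_integral_def
    by (rule integral_FTC_atLeastAtMost)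
       (use F continuous_on_subset[OF cf] in \<open>auto simp: has_real_derivative_iff_has_vector_derivative[symmetric]
          intro: has_field_derivative_at_within\<close>)
  also have "\<dots> = 0" using param_plus_1[of 0] by (simp add: F_def)
  finally show ?thesis by simp
qed

lemma weak_tangential_derivativeI:
  assumes \<Gamma>: "openin (top_of_set (frontier \<Omega>)) \<Gamma>"
    and u: "continuous_on (frontier \<Omega>) u" and w: "continuous_on (frontier \<Omega>) w"
    and uw: "tangential_derivative \<Omega> u w" and fu: "\<And>x. x \<in> \<Gamma> \<Longrightarrow> f x = u x"
  shows "weak_tangential_derivative \<Omega> \<Gamma> f w"
  unfolding weak_tangential_derivative_def
proof (intro conjI allI impI)
  have sub: "\<Gamma> \<subseteq> frontier \<Omega>" using \<Gamma> by (rule openin_imp_subset)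
  show "w \<in> borel_measurable (restrict_space \<mu> \<Gamma>)"
    by (rule restrict_measurable[OF continuous_on_subset[OF w sub]])
  have "compact (frontier \<Omega>)" using bounded_domain by (simp add: compact_frontier_bounded)
  then have "bounded (w ` frontier \<Omega>)"
    using w by (intro compact_imp_bounded compact_continuous_image)
  then obtain B where B: "\<And>x. x \<in> frontier \<Omega> \<Longrightarrow> \<bar>w x\<bar> \<le> B" by (auto simp: bounded_iff)
  show "Linf_enorm \<Omega> \<Gamma> w < \<infinity>"
    using B sub continuous_on_subset[OF w sub]
    by (intro Linf_enorm_finite[where c = "\<lambda>x. \<bar>w x\<bar>" and B = B] continuous_on_rabs) auto
  fix \<phi> \<psi>
  assume *: "tangential_derivative \<Omega> \<phi> \<psi> \<and> continuous_on (frontier \<Omega>) \<psi> \<and>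
            closure {x \<in> frontier \<Omega>. \<phi> x \<noteq> 0} \<subseteq> \<Gamma>"
  have "(LINT x:\<Gamma>|\<mu>. f x * \<psi> x) = (LINT x:\<Gamma>|\<mu>. u x * \<psi> x)"
    using openin_frontier_borel[OF \<Gamma>] fu by (intro set_lebesgue_integral_cong) auto
  also have "\<dots> = - (LINT x:\<Gamma>|\<mu>. w x * \<phi> x)"
    using * by (intro integral_by_parts_arclength[OF \<Gamma> u w uw]) auto
  finally show "(LINT x:\<Gamma>|\<mu>. f x * \<psi> x) = - (LINT x:\<Gamma>|\<mu>. w x * \<phi> x)" .
qed

text \<open>The square of the positive part of \<open>r\<^sup>2 - \<bar>x - x0\<bar>\<^sup>2\<close> is a \<open>C\<^sup>1\<close> function on the plane. Restricting a
  function of the plane, rather than transplanting one of the parameter, avoids the case of an arc which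
  contains the end points of the period.\<close>

lemma tangential_bump:
  assumes r: "r > 0"
  obtains \<phi> \<psi> :: "complex \<Rightarrow> real" where "tangential_derivative \<Omega> \<phi> \<psi>" "continuous_on (frontier \<Omega>) \<psi>"
    "continuous_on UNIV \<phi>" "\<And>x. \<phi> x \<ge> 0" "\<And>x. dist x x0 < r \<Longrightarrow> \<phi> x > 0" "\<And>x. dist x x0 \<ge> r \<Longrightarrow> \<phi> x = 0"
proof -
  define q where "q s = (max 0 s)\<^sup>2" for s :: real
  define \<phi> where "\<phi> x = q (r\<^sup>2 - (norm (x - x0))\<^sup>2)" for x :: complex
  define \<psi> where "\<psi> x = 2 * max 0 (r\<^sup>2 - (norm (x - x0))\<^sup>2) * (- 2 * ((x - x0) \<bullet> unit_tangent x))" for x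
  have q: "(q has_real_derivative 2 * max 0 s) (at s)" for s
  proof (cases s "0::real" rule: linorder_cases)
    case less
    then have "\<forall>\<^sub>F s in nhds s. q s = 0"
      using eventually_nhds_in_open[of "{..<0}" s] by (auto elim!: eventually_mono simp: q_def)
    then have "(q has_real_derivative 0) (at s) \<longleftrightarrow> ((\<lambda>_. 0) has_real_derivative 0) (at s)"
      by (intro DERIV_cong_ev) auto
    then show ?thesis using less by simp
  next
    case greater
    then have "\<forall>\<^sub>F s in nhds s. q s = s\<^sup>2"
      using eventually_nhds_in_open[of "{0<..}" s] by (auto elim!: eventually_mono simp: q_def)
    then have "(q has_real_derivative 2 * s) (at s) \<longleftrightarrow> ((\<lambda>s. s\<^sup>2) has_real_derivative 2 * s) (at s)"
      by (intro DERIV_cong_ev) auto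
    moreover have "((\<lambda>s. s\<^sup>2) has_real_derivative 2 * s) (at s)" by (auto intro!: derivative_eq_intros)
    ultimately show ?thesis using greater by simp
  next
    case equal
    have "(\<lambda>h. (q (0 + h) - q 0) / h) \<midarrow>0\<rightarrow> 0"
    proof (rule Lim_null_comparison)
      show "\<forall>\<^sub>F h in at 0. norm ((q (0 + h) - q 0) / h) \<le> \<bar>h\<bar>"
        by (rule always_eventually) (auto simp: q_def max_def power2_eq_square)
      show "(\<lambda>h::real. \<bar>h\<bar>) \<midarrow>0\<rightarrow> 0" using tendsto_rabs_zero[OF tendsto_ident_at] .
    qed
    then show ?thesis using equal by (simp add: DERIV_def)
  qed
  show thesis
  proof
    show "tangential_derivative \<Omega> \<phi> \<psi>"
      unfolding tangential_derivative_def
    proof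
      fix t
      have \<gamma>': "(\<gamma> has_derivative (\<lambda>h. h *\<^sub>R velocity t)) (at t)"
        using param_deriv by (simp add: has_vector_derivative_def)
      have "((\<lambda>t. r\<^sup>2 - (norm (\<gamma> t - x0))\<^sup>2) has_derivative
          (\<lambda>h. - 2 * ((\<gamma> t - x0) \<bullet> velocity t) * h)) (at t)"
      proof -
        have "((\<lambda>t. r\<^sup>2 - (\<gamma> t - x0) \<bullet> (\<gamma> t - x0)) has_derivative
            (\<lambda>h. 0 - ((\<gamma> t - x0) \<bullet> (h *\<^sub>R velocity t - 0) + (h *\<^sub>R velocity t - 0) \<bullet> (\<gamma> t - x0)))) (at t)"
          by (intro has_derivative_diff has_derivative_const has_derivative_inner \<gamma>')
        moreover have "(\<lambda>h. 0 - ((\<gamma> t - x0) \<bullet> (h *\<^sub>R velocity t - 0) + (h *\<^sub>R velocity t - 0) \<bullet> (\<gamma> t - x0)))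
            = (\<lambda>h. - 2 * ((\<gamma> t - x0) \<bullet> velocity t) * h)"
          by (simp add: fun_eq_iff inner_commute mult_ac)
        ultimately show ?thesis by (simp only: power2_norm_eq_inner)
      qed
      then have "((\<lambda>t. r\<^sup>2 - (norm (\<gamma> t - x0))\<^sup>2) has_real_derivative
          - 2 * ((\<gamma> t - x0) \<bullet> velocity t)) (at t)"
        by (simp only: has_field_derivative_def)
      from DERIV_chain2[OF q this]
      have "((\<lambda>t. \<phi> (\<gamma> t)) has_real_derivative
          2 * max 0 (r\<^sup>2 - (norm (\<gamma> t - x0))\<^sup>2) * (- 2 * ((\<gamma> t - x0) \<bullet> velocity t))) (at t)"
        by (simp add: \<phi>_def)
      also have "2 * max 0 (r\<^sup>2 - (norm (\<gamma> t - x0))\<^sup>2) * (- 2 * ((\<gamma> t - x0) \<bullet> velocity t))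
          = \<psi> (\<gamma> t) * boundary_speed \<Omega> t"
        unfolding \<psi>_def boundary_speed_eq by (subst velocity_eq) simp
      finally show "((\<lambda>t. \<phi> (\<gamma> t)) has_real_derivative \<psi> (\<gamma> t) * boundary_speed \<Omega> t) (at t)" .
    qed
    show "continuous_on (frontier \<Omega>) \<psi>"
      unfolding \<psi>_def by (intro continuous_intros continuous_unit_tangent)
    show "continuous_on UNIV \<phi>" unfolding \<phi>_def q_def by (intro continuous_intros)
    show "\<phi> x \<ge> 0" for x by (simp add: \<phi>_def q_def)
    show "\<phi> x > 0" if "dist x x0 < r" for x
    proof -
      have "(norm (x - x0))\<^sup>2 < r\<^sup>2" using that by (intro power_strict_mono) (auto simp: dist_norm)
      then show ?thesis by (simp add: \<phi>_def q_def)
    qed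
    show "\<phi> x = 0" if "dist x x0 \<ge> r" for x
    proof -
      have "r\<^sup>2 \<le> (norm (x - x0))\<^sup>2" using that r by (intro power_mono) (auto simp: dist_norm)
      then show ?thesis by (simp add: \<phi>_def q_def)
    qed
  qed
qed

text \<open>Uniqueness of weak derivatives in the form that is needed: if \<open>\<bar>v\<bar>\<close> exceeded the norm of \<open>w\<close> at \<open>x\<close>, then
  either \<open>v > w\<close> or \<open>v < w\<close> would hold almost everywhere on an arc around \<open>x\<close>, and \<open>v\<close> and \<open>w\<close>
  would have different integrals against a bump supported in this arc.\<close>

lemma weak_tangential_derivative_ge:
  assumes \<Gamma>: "openin (top_of_set (frontier \<Omega>)) \<Gamma>"
    and v: "continuous_on (frontier \<Omega>) v" and vf: "weak_tangential_derivative \<Omega> \<Gamma> f v"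
    and wf: "weak_tangential_derivative \<Omega> \<Gamma> f w" and x: "x \<in> \<Gamma>"
  shows "\<bar>v x\<bar> \<le> Linf_norm \<Omega> \<Gamma> w"
proof (rule ccontr)
  interpret finite_measure \<mu> by (rule finite_arclength)
  let ?W = "Linf_norm \<Omega> \<Gamma> w"
  assume contr: "\<not> \<bar>v x\<bar> \<le> ?W"
  have sub: "\<Gamma> \<subseteq> frontier \<Omega>" using \<Gamma> by (rule openin_imp_subset)
  have \<Gamma>b [measurable]: "\<Gamma> \<in> sets borel" by (rule openin_frontier_borel[OF \<Gamma>])
  have ne: "\<Gamma> \<noteq> {}" using x by blast
  have wm: "w \<in> borel_measurable (restrict_space \<mu> \<Gamma>)" and fin: "Linf_enorm \<Omega> \<Gamma> w < \<infinity>"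
    using wf by (auto simp: weak_tangential_derivative_def)
  have W: "AE x in \<mu>. x \<in> \<Gamma> \<longrightarrow> \<bar>w x\<bar> \<le> ?W"
    using Linf_norm_AE_bound(1)[OF \<Gamma> ne fin] by (simp add: AE_restrict_space_iff)
  \<comment> \<open>The sign reduces the case of negative \<open>v x\<close> to that of positive \<open>v x\<close>.\<close>
  define \<sigma> where "\<sigma> = sgn (v x)"
  have \<sigma>: "\<bar>\<sigma>\<bar> \<le> 1" "\<sigma> * v x > ?W" using contr by (auto simp: \<sigma>_def sgn_if)
  define V where "V = \<Gamma> \<inter> (\<lambda>y. \<sigma> * v y) -` {?W<..}"
  have "openin (top_of_set \<Gamma>) V"
    unfolding V_def using continuous_on_mult_left[OF continuous_on_subset[OF v sub], of \<sigma>]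
    by (simp add: continuous_openin_preimage_eq)
  then have V: "openin (top_of_set (frontier \<Omega>)) V" using \<Gamma> by (rule openin_trans)
  have xV: "x \<in> V" using x \<sigma> by (simp add: V_def)
  obtain r where r: "r > 0" "\<And>y. y \<in> frontier \<Omega> \<Longrightarrow> dist y x < r \<Longrightarrow> y \<in> V"
    using V xV unfolding openin_euclidean_subtopology_iff by (metis dist_commute)
  have "r / 2 > 0" using r by simp
  then obtain \<phi> \<psi> where td: "tangential_derivative \<Omega> \<phi> \<psi>" "continuous_on (frontier \<Omega>) \<psi>"
    and \<phi>: "continuous_on UNIV \<phi>" "\<And>y. \<phi> y \<ge> 0" "\<And>y. dist y x < r / 2 \<Longrightarrow> \<phi> y > 0"
      "\<And>y. dist y x \<ge> r / 2 \<Longrightarrow> \<phi> y = 0"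
    by (rule tangential_bump[of "r / 2" x]) (rule that, assumption+)
  have "closure {y \<in> frontier \<Omega>. \<phi> y \<noteq> 0} \<subseteq> frontier \<Omega> \<inter> cball x (r / 2)"
    using \<phi>(4) by (intro closure_minimal) (auto simp: dist_commute not_le[symmetric] less_imp_le
        intro: ccontr)
  also have "\<dots> \<subseteq> V" using r by (auto simp: dist_commute)
  finally have supp: "closure {y \<in> frontier \<Omega>. \<phi> y \<noteq> 0} \<subseteq> \<Gamma>" by (auto simp: V_def)
  have eq: "(LINT x:\<Gamma>|\<mu>. v x * \<phi> x) = (LINT x:\<Gamma>|\<mu>. w x * \<phi> x)"
    using vf wf td supp unfolding weak_tangential_derivative_def
    by (metis (no_types, lifting) neg_equal_iff_equal)
  have iv: "set_integrable \<mu> \<Gamma> (\<lambda>x. v x * \<phi> x)"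
    by (intro integrable_arclength_continuous[OF _ \<Gamma>] continuous_intros v continuous_on_subset[OF \<phi>(1)]) auto
  have i\<phi>: "set_integrable \<mu> \<Gamma> \<phi>"
    by (intro integrable_arclength_continuous[OF _ \<Gamma>] continuous_on_subset[OF \<phi>(1)]) auto
  have iw: "set_integrable \<mu> \<Gamma> (\<lambda>x. w x * \<phi> x)"
  proof (rule set_integrable_bound)
    show "set_integrable \<mu> \<Gamma> (\<lambda>x. ?W * \<phi> x)" using i\<phi> by simp
    have "(\<lambda>x. w x * \<phi> x) \<in> borel_measurable (restrict_space \<mu> \<Gamma>)"
      using wm restrict_measurable[OF continuous_on_subset[OF \<phi>(1) subset_UNIV], of \<Gamma>] by measurable
    then show "set_borel_measurable \<mu> \<Gamma> (\<lambda>x. w x * \<phi> x)"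
      unfolding set_borel_measurable_def by (subst (asm) borel_measurable_restrict_space_iff) auto
    show "AE x in \<mu>. x \<in> \<Gamma> \<longrightarrow> norm (w x * \<phi> x) \<le> norm (?W * \<phi> x)"
      using W
    proof eventually_elim
      case (elim y)
      show ?case
      proof
        assume "y \<in> \<Gamma>"
        then have "\<bar>w y\<bar> * \<bar>\<phi> y\<bar> \<le> \<bar>?W\<bar> * \<bar>\<phi> y\<bar>" using elim by (intro mult_right_mono) auto
        then show "norm (w y * \<phi> y) \<le> norm (?W * \<phi> y)" by (simp add: abs_mult)
      qed
    qed
  qed
  define g where "g y = indicator \<Gamma> y *\<^sub>R (\<sigma> * (v y * \<phi> y) - \<sigma> * (w y * \<phi> y))" for y
  have gpos: "AE y in \<mu>. (y \<in> V \<longrightarrow> \<phi> y > 0 \<longrightarrow> g y > 0) \<and> 0 \<le> g y"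
    using W
  proof eventually_elim
    case (elim y)
    have key: "\<phi> y * (\<sigma> * v y - \<sigma> * w y) > 0" if "y \<in> V" "\<phi> y > 0"
    proof -
      have "y \<in> \<Gamma>" "\<sigma> * v y > ?W" using that(1) by (auto simp: V_def)
      have "\<sigma> * w y \<le> \<bar>\<sigma>\<bar> * \<bar>w y\<bar>" by (metis abs_ge_self abs_mult)
      also have "\<dots> \<le> 1 * \<bar>w y\<bar>" using \<sigma>(1) by (intro mult_right_mono) auto
      also have "\<dots> \<le> ?W" using elim \<open>y \<in> \<Gamma>\<close> by simp
      finally show ?thesis using \<open>\<sigma> * v y > ?W\<close> that(2) by simp
    qed
    have g: "g y = indicator \<Gamma> y * (\<phi> y * (\<sigma> * v y - \<sigma> * w y))"
      by (simp add: g_def algebra_simps)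
    have V\<Gamma>: "V \<subseteq> \<Gamma>" by (auto simp: V_def)
    show ?case
    proof (intro conjI impI)
      show "g y > 0" if "y \<in> V" "\<phi> y > 0" using key[OF that] that V\<Gamma> by (auto simp: g)
      show "0 \<le> g y"
      proof (cases "y \<in> \<Gamma> \<and> \<phi> y \<noteq> 0")
        case True
        then have "dist y x < r / 2" using \<phi>(4)[of y] by force
        then have "y \<in> V" using r True sub by force
        moreover have "\<phi> y > 0" using \<phi>(3) \<open>dist y x < r / 2\<close> .
        ultimately show ?thesis using key V\<Gamma> by (auto simp: g intro: less_imp_le)
      next
        case False
        then show ?thesis by (auto simp: g)
      qed
    qed
  qed
  have ig: "integrable \<mu> g"
    unfolding g_def scaleR_right_diff_distrib
    using set_integrable_mult_right[OF iv, of \<sigma>] set_integrable_mult_right[OF iw, of \<sigma>]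
    unfolding set_integrable_def by (intro Bochner_Integration.integrable_diff) auto
  have "integral\<^sup>L \<mu> g = (LINT x:\<Gamma>|\<mu>. \<sigma> * (v x * \<phi> x)) - (LINT x:\<Gamma>|\<mu>. \<sigma> * (w x * \<phi> x))"
    unfolding g_def using set_integral_diff(2)[OF set_integrable_mult_right[OF iv, of \<sigma>]
        set_integrable_mult_right[OF iw, of \<sigma>]]
    by (simp add: set_lebesgue_integral_def)
  also have "\<dots> = 0" using eq by simp
  finally have "AE y in \<mu>. g y = 0"
    using integral_nonneg_eq_0_iff_AE[OF ig] gpos by (auto elim: eventually_mono)
  with gpos have AE0: "AE y in \<mu>. y \<notin> frontier \<Omega> \<inter> ball x (r / 2)"
  proof eventually_elim
    case (elim y)
    show ?case
    proof
      assume y: "y \<in> frontier \<Omega> \<inter> ball x (r / 2)"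
      then have "y \<in> V" "\<phi> y > 0" using r \<phi>(3)[of y] by (auto simp: dist_commute)
      then show False using elim by simp
    qed
  qed
  have op: "openin (top_of_set (frontier \<Omega>)) (frontier \<Omega> \<inter> ball x (r / 2))"
    by (rule openin_open_Int) simp
  have "frontier \<Omega> \<inter> ball x (r / 2) \<in> null_sets \<mu>"
    using AE0 openin_frontier_borel[OF op] by (subst AE_iff_null_sets) auto
  moreover have "x \<in> frontier \<Omega> \<inter> ball x (r / 2)" using x sub r by auto
  ultimately show False using arclength_pos[OF op] by blast
qed

end

section \<open>Cauchy data\<close>

text \<open>The columns of an orthogonal matrix are orthonormal if its rows are.\<close>

lemma orthonormal_plane:
  fixes w \<nu> T :: complex
  assumes "norm \<nu> = 1" "norm T = 1" "\<nu> \<bullet> T = 0"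
  shows "(norm w)\<^sup>2 = (w \<bullet> T)\<^sup>2 + (w \<bullet> \<nu>)\<^sup>2"
proof -
  obtain x y a b c d where w: "w = Complex x y" and T: "T = Complex a b" and \<nu>: "\<nu> = Complex c d"
    by (metis complex.collapse)
  have 1: "c\<^sup>2 + d\<^sup>2 = 1" "a\<^sup>2 + b\<^sup>2 = 1" "c * a + d * b = 0"
    using assms by (auto simp: w T \<nu> complex_norm inner_complex_def)
  define l where "l = a * d - b * c"
  have c: "c = - b * l" and d: "d = a * l"
    using 1 unfolding l_def by algebra+
  have "l\<^sup>2 = 1" using 1 unfolding l_def by algebra
  then have "(x * a + y * b)\<^sup>2 + (x * c + y * d)\<^sup>2 = x\<^sup>2 + y\<^sup>2"
    using 1(2) unfolding c d by algebra
  then show ?thesis by (simp add: w T \<nu> inner_complex_def cmod_power2)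
qed

context smooth_boundary
begin

text \<open>The weak derivative in the norm of \<open>f\<close> is chosen arbitrarily, but it dominates the classical
  derivative \<open>v\<close> of \<open>u\<close> along the boundary. Together with the normal derivative \<open>g\<close> this bounds the whole gradient.\<close>

lemma cauchy_data_bound:
  assumes \<Gamma>: "openin (top_of_set (frontier \<Omega>)) \<Gamma>"
    and \<nu>: "\<And>x. x \<in> frontier \<Omega> \<Longrightarrow> is_outer_unit_normal \<Omega> x (\<nu> x)"
    and C1: "C1_closure_with_gradient \<Omega> u G"
    and f: "\<And>x. x \<in> \<Gamma> \<Longrightarrow> u x = f x" and g: "\<And>x. x \<in> \<Gamma> \<Longrightarrow> G x \<bullet> \<nu> x = g x"
    and x: "x \<in> \<Gamma>"
  shows "\<bar>u x\<bar> \<le> W1inf_norm \<Omega> \<Gamma> f + Linf_norm \<Omega> \<Gamma> g"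
    and "norm (G x) \<le> W1inf_norm \<Omega> \<Gamma> f + Linf_norm \<Omega> \<Gamma> g"
proof -
  have sub: "\<Gamma> \<subseteq> frontier \<Omega>" using \<Gamma> by (rule openin_imp_subset)
  have xf: "x \<in> frontier \<Omega>" and ne: "\<Gamma> \<noteq> {}" using x sub by auto
  have frc: "frontier \<Omega> \<subseteq> closure \<Omega>" by (simp add: frontier_def)
  have cu: "continuous_on (frontier \<Omega>) u" and cG: "continuous_on (frontier \<Omega>) G"
    using C1 frc by (auto simp: C1_closure_with_gradient_def intro: continuous_on_subset)
  have cmp: "compact (frontier \<Omega>)" using bounded_domain by (simp add: compact_frontier_bounded)
  have bdd: "\<exists>B. \<forall>y\<in>\<Gamma>. c y \<le> B" if "continuous_on (frontier \<Omega>) c" for c :: "complex \<Rightarrow> real"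
  proof -
    have "bounded (c ` frontier \<Omega>)"
      using that cmp by (intro compact_imp_bounded compact_continuous_image)
    then obtain B where "\<forall>y\<in>frontier \<Omega>. \<bar>c y\<bar> \<le> B" by (auto simp: bounded_iff)
    then have "c y \<le> B" if "y \<in> \<Gamma>" for y using that sub abs_le_D1 by blast
    then show ?thesis by blast
  qed
  have norm_le: "\<bar>k y\<bar> \<le> Linf_norm \<Omega> \<Gamma> k" "Linf_norm \<Omega> \<Gamma> k \<ge> 0"
    if c: "continuous_on (frontier \<Omega>) c" and eq: "\<And>y. y \<in> \<Gamma> \<Longrightarrow> \<bar>k y\<bar> = c y" and y: "y \<in> \<Gamma>"
    for c k :: "complex \<Rightarrow> real" and y
  proof -
    obtain B where B: "\<And>y. y \<in> \<Gamma> \<Longrightarrow> c y \<le> B" using bdd[OF c] by blast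
    have c': "continuous_on \<Gamma> c" using c sub by (rule continuous_on_subset)
    show "\<bar>k y\<bar> \<le> Linf_norm \<Omega> \<Gamma> k" by (rule continuous_le_Linf_norm[OF \<Gamma> c' eq B y])
    show "Linf_norm \<Omega> \<Gamma> k \<ge> 0" by (rule Linf_norm_AE_bound(2)[OF \<Gamma> ne Linf_enorm_finite[OF c' eq B]])
  qed
  have f_le: "\<bar>f x\<bar> \<le> Linf_norm \<Omega> \<Gamma> f" "Linf_norm \<Omega> \<Gamma> f \<ge> 0"
    using norm_le[of "\<lambda>y. \<bar>u y\<bar>" f, OF continuous_on_rabs[OF cu] _ x] f by auto
  define v where "v y = G y \<bullet> unit_tangent y" for y
  have cv: "continuous_on (frontier \<Omega>) v"
    unfolding v_def by (intro continuous_intros cG continuous_unit_tangent)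
  have uv: "tangential_derivative \<Omega> u v"
    unfolding tangential_derivative_def
  proof
    fix t
    have "G (\<gamma> t) \<bullet> velocity t = v (\<gamma> t) * boundary_speed \<Omega> t"
      unfolding v_def boundary_speed_eq by (subst velocity_eq) simp
    then show "((\<lambda>t. u (\<gamma> t)) has_real_derivative v (\<gamma> t) * boundary_speed \<Omega> t) (at t)"
      using trace_has_derivative[OF C1 \<nu>[OF param_in_frontier], of t] by simp
  qed
  have vf: "weak_tangential_derivative \<Omega> \<Gamma> f v"
    using f by (intro weak_tangential_derivativeI[OF \<Gamma> cu cv uv]) simp
  define w where "w = (SOME w. weak_tangential_derivative \<Omega> \<Gamma> f w)"
  have wf: "weak_tangential_derivative \<Omega> \<Gamma> f w" 
    unfolding w_def by (rule someI[of "weak_tangential_derivative \<Omega> \<Gamma> f", OF vf])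
  have v_le: "\<bar>v x\<bar> \<le> Linf_norm \<Omega> \<Gamma> w"
    by (rule weak_tangential_derivative_ge[OF \<Gamma> cv vf wf x])
  have W: "W1inf_norm \<Omega> \<Gamma> f = Linf_norm \<Omega> \<Gamma> f + Linf_norm \<Omega> \<Gamma> w"
    by (simp add: W1inf_norm_def w_def)
  have split: "(norm (G y))\<^sup>2 = (v y)\<^sup>2 + (G y \<bullet> \<nu> y)\<^sup>2" if y: "y \<in> frontier \<Omega>" for y
    unfolding v_def
  proof (rule orthonormal_plane)
    obtain t where t: "y = \<gamma> t" using y param_range by blast
    have n: "is_outer_unit_normal \<Omega> (\<gamma> t) (\<nu> y)" using \<nu>[OF y] t by simp
    show "norm (\<nu> y) = 1" using n by (simp add: is_outer_unit_normal_def)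
    show "norm (unit_tangent y) = 1" using y by (rule norm_unit_tangent)
    show "\<nu> y \<bullet> unit_tangent y = 0"
      using outer_normal_orthogonal[OF n] by (simp add: t unit_tangent_param sgn_div_norm)
  qed
  have g_le: "\<bar>g x\<bar> \<le> Linf_norm \<Omega> \<Gamma> g" "Linf_norm \<Omega> \<Gamma> g \<ge> 0"
  proof -
    \<comment> \<open>This shows that \<open>\<bar>g\<bar>\<close> is continuous on \<open>\<Gamma>\<close>, although \<open>\<nu>\<close> is given only pointwise.\<close>
    have eq: "\<bar>g y\<bar> = sqrt ((norm (G y))\<^sup>2 - (v y)\<^sup>2)" if "y \<in> \<Gamma>" for y
      using split[of y] that sub g[OF that] by auto
    have c: "continuous_on (frontier \<Omega>) (\<lambda>y. sqrt ((norm (G y))\<^sup>2 - (v y)\<^sup>2))"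
      by (intro continuous_intros cG cv)
    show "\<bar>g x\<bar> \<le> Linf_norm \<Omega> \<Gamma> g" "Linf_norm \<Omega> \<Gamma> g \<ge> 0" using norm_le[OF c eq x] by auto
  qed
  show "\<bar>u x\<bar> \<le> W1inf_norm \<Omega> \<Gamma> f + Linf_norm \<Omega> \<Gamma> g"
    using f_le g_le(2) v_le f[OF x] W by simp
  have "(norm (G x))\<^sup>2 \<le> (\<bar>v x\<bar> + \<bar>g x\<bar>)\<^sup>2"
    using split[OF xf] g[OF x] by (simp add: power2_sum)
  then have "norm (G x) \<le> \<bar>v x\<bar> + \<bar>g x\<bar>" by (rule power2_le_imp_le) simp
  then show "norm (G x) \<le> W1inf_norm \<Omega> \<Gamma> f + Linf_norm \<Omega> \<Gamma> g"
    using f_le g_le v_le W by simp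
qed

end

lemma C1_norm_bound:
  assumes "bounded \<Omega>" and C1: "C1_closure_with_gradient \<Omega> u G" and M: "C1_norm \<Omega> u G \<le> M"
    and z: "z \<in> closure \<Omega>"
  shows "\<bar>u z\<bar> \<le> M" "norm (G z) \<le> M"
proof -
  have cmp: "compact (closure \<Omega>)" using \<open>bounded \<Omega>\<close> by (simp add: compact_closure)
  have cu: "continuous_on (closure \<Omega>) u" and cG: "continuous_on (closure \<Omega>) G"
    using C1 by (auto simp: C1_closure_with_gradient_def)
  have "bdd_above ((\<lambda>x. \<bar>u x\<bar>) ` closure \<Omega>)" "bdd_above ((\<lambda>x. norm (G x)) ` closure \<Omega>)"
    by (rule bounded_imp_bdd_above[OF compact_imp_bounded[OF compact_continuous_image[OF _ cmp]]],
        intro continuous_on_rabs continuous_on_norm cu cG)+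
  then have "\<bar>u z\<bar> \<le> (SUP x\<in>closure \<Omega>. \<bar>u x\<bar>)" "norm (G z) \<le> (SUP x\<in>closure \<Omega>. norm (G x))"
    using cSUP_upper[OF z, of "\<lambda>x. \<bar>u x\<bar>"] cSUP_upper[OF z, of "\<lambda>x. norm (G x)"] by blast+
  then show "\<bar>u z\<bar> \<le> M" "norm (G z) \<le> M"
    using M norm_ge_zero[of "G z"] abs_ge_zero[of "u z"] unfolding C1_norm_def by linarith+
qed

text \<open>Near \<open>\<Gamma>\<close> the function \<open>\<tau>\<close> is close to \<open>1\<close>, so \<open>u\<close> and its gradient vanish on a nonempty open set. The
  holomorphic function \<open>cnj G\<close> then vanishes on all of \<open>\<Omega>\<close>, and \<open>u\<close> is constant.\<close>

lemma zero_cauchy_data: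
  assumes smooth: "smooth_simply_connected_domain \<Omega>"
    and \<Gamma>: "openin (top_of_set (frontier \<Omega>)) \<Gamma>" "\<Gamma> \<noteq> {}"
    and C1: "C1_closure_with_gradient \<Omega> u G" and u: "harmonic_on u \<Omega>"
    and \<tau>: "is_harmonic_measure \<Omega> \<Gamma> \<tau>"
    and zero: "\<And>z. z \<in> \<Omega> \<Longrightarrow> \<tau> z > 0 \<Longrightarrow> u z = 0"
    and z: "z \<in> \<Omega>"
  shows "u z = 0"
proof -
  have \<Omega>: "open \<Omega>" "connected \<Omega>"
    using smooth by (auto simp: smooth_simply_connected_domain_def)
  have G: "\<And>x. x \<in> \<Omega> \<Longrightarrow> GDERIV u x :> G x"
    using C1 by (auto simp: C1_closure_with_gradient_def)
  obtain p where p: "p \<in> \<Gamma>" using \<Gamma> by blast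
  obtain T where T: "open T" "\<Gamma> = frontier \<Omega> \<inter> T" using \<Gamma>(1) by (auto simp: openin_open)
  \<comment> \<open>As \<open>\<Gamma>\<close> is relatively open, no point of \<open>\<Gamma>\<close> is a jump of the boundary data of \<open>\<tau>\<close>.\<close>
  have "p \<notin> closure (frontier \<Omega> - closure \<Gamma>)"
  proof
    assume "p \<in> closure (frontier \<Omega> - closure \<Gamma>)"
    then obtain q where "q \<in> T" "q \<in> frontier \<Omega> - closure \<Gamma>"
      using T p open_Int_closure_eq_empty[OF T(1), of "frontier \<Omega> - closure \<Gamma>"] by blast
    then show False using T closure_subset[of \<Gamma>] by blast
  qed
  then have lim: "(\<tau> \<longlongrightarrow> 1) (at p within \<Omega>)"
    using \<tau> p closure_subset[of \<Gamma>] by (auto simp: is_harmonic_measure_def)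
  have ev: "\<forall>\<^sub>F z in at p within \<Omega>. \<tau> z > 0"
    using lim by (rule order_tendstoD(1)) simp
  have pfr: "p \<in> frontier \<Omega>" "p \<notin> \<Omega>"
    using p T \<Omega>(1) by (auto simp: frontier_def interior_open)
  then have "at p within \<Omega> \<noteq> bot"
    by (auto simp: frontier_def closure_def trivial_limit_within)
  moreover have "\<forall>\<^sub>F z in at p within \<Omega>. z \<in> \<Omega>" by (simp add: eventually_at_filter)
  ultimately obtain z0 where z0: "z0 \<in> \<Omega>" "\<tau> z0 > 0"
    using ev eventually_happens[of "\<lambda>z. \<tau> z > 0 \<and> z \<in> \<Omega>" "at p within \<Omega>"] eventually_conj
    by blast
  define U where "U = \<Omega> \<inter> \<tau> -` {0<..}"
  have "open U"
    unfolding U_def using \<tau> \<Omega>(1)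
    by (intro continuous_open_preimage harmonic_on_imp_continuous_on)
       (auto simp: is_harmonic_measure_def)
  have z0U: "z0 \<in> U" using z0 by (simp add: U_def)
  have GU: "G x = 0" if "x \<in> U" for x
  proof -
    have "(u has_derivative (\<lambda>_. 0)) (at x)"
      by (rule has_derivative_transform_within_open[OF has_derivative_const \<open>open U\<close> that])
         (auto simp: U_def zero)
    then have "GDERIV u x :> 0" by (simp add: gderiv_def)
    then show ?thesis using G[of x] that GDERIV_unique by (auto simp: U_def)
  qed
  have cnj0: "cnj (G w) = 0" if "w \<in> \<Omega>" for w
  proof (rule analytic_continuation[OF cnj_gradient_holomorphic[OF u \<Omega>(1) G] \<Omega>, of U z0])
    show "z0 islimpt U" using \<open>open U\<close> z0U by (simp add: interior_limit_point interior_open)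
  qed (use that z0 GU in \<open>auto simp: U_def\<close>)
  have "(u has_derivative (\<lambda>_. 0)) (at w)" if "w \<in> \<Omega>" for w
    using G[OF that] cnj0[OF that] by (simp add: gderiv_def)
  then have "u z = u z0" by (rule has_derivative_zero_unique_connected[OF \<Omega> _ z z0(1)])
  then show ?thesis using z0 zero by simp
qed

theorem theorem2p1:
  fixes \<Omega> :: "complex set" and M :: real
  assumes "smooth_simply_connected_domain \<Omega>" and "M > 0"
  shows "\<exists>C>0. \<forall>(\<Gamma> :: complex set) (\<nu> :: complex \<Rightarrow> complex) (u :: complex \<Rightarrow> real)
            (G :: complex \<Rightarrow> complex) (f :: complex \<Rightarrow> real) (g :: complex \<Rightarrow> real)
            (\<tau> :: complex \<Rightarrow> real).
           openin (top_of_set (frontier \<Omega>)) \<Gamma> \<and> \<Gamma> \<noteq> {} \<and>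
           (\<forall>x\<in>frontier \<Omega>. is_outer_unit_normal \<Omega> x (\<nu> x)) \<and>
           C1_closure_with_gradient \<Omega> u G \<and>
           harmonic_on u \<Omega> \<and>
           (\<forall>x\<in>\<Gamma>. u x = f x) \<and>
           (\<forall>x\<in>\<Gamma>. G x \<bullet> \<nu> x = g x) \<and>
           C1_norm \<Omega> u G \<le> M \<and>
           is_harmonic_measure \<Omega> \<Gamma> \<tau>
           \<longrightarrow> (\<forall>x\<in>\<Omega>. \<bar>u x\<bar> \<le> C * (W1inf_norm \<Omega> \<Gamma> f + Linf_norm \<Omega> \<Gamma> g) powr \<tau> x)"
proof -
  interpret smooth_boundary \<Omega> by unfold_locales (rule assms(1))
  obtain R where R: "\<And>z. z \<in> \<Omega> \<Longrightarrow> norm z \<le> R"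
    using bounded_domain by (auto simp: bounded_iff)
  define A where "A = max M 1"
  define C where "C = A * exp (2 * R\<^sup>2)"
  have A: "A \<ge> 1" "M \<le> A" by (auto simp: A_def)
  have C: "C > 0" "A \<le> C" using A by (auto simp: C_def)
  show ?thesis
  proof (intro exI[of _ C] conjI C(1) allI impI ballI, elim conjE)
    fix \<Gamma> \<nu> u G f g \<tau> x
    assume \<Gamma>: "openin (top_of_set (frontier \<Omega>)) \<Gamma>" "\<Gamma> \<noteq> {}"
      and \<nu>: "\<forall>x\<in>frontier \<Omega>. is_outer_unit_normal \<Omega> x (\<nu> x)"
      and C1: "C1_closure_with_gradient \<Omega> u G" and u: "harmonic_on u \<Omega>"
      and f: "\<forall>x\<in>\<Gamma>. u x = f x" and g: "\<forall>x\<in>\<Gamma>. G x \<bullet> \<nu> x = g x"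
      and M: "C1_norm \<Omega> u G \<le> M" and \<tau>: "is_harmonic_measure \<Omega> \<Gamma> \<tau>" and x: "x \<in> \<Omega>"
    define \<epsilon> where "\<epsilon> = W1inf_norm \<Omega> \<Gamma> f + Linf_norm \<Omega> \<Gamma> g"
    have cu: "continuous_on (closure \<Omega>) u" and cG: "continuous_on (closure \<Omega>) G"
      using C1 by (auto simp: C1_closure_with_gradient_def)
    have bound: "\<bar>u z\<bar> \<le> A" "norm (G z) \<le> A" if "z \<in> closure \<Omega>" for z
      using C1_norm_bound[OF bounded_domain C1 M that] A(2) by auto
    have data: "\<bar>u y\<bar> \<le> \<epsilon>" "norm (G y) \<le> \<epsilon>" if y: "y \<in> \<Gamma>" for y
    proof -
      have \<nu>': "is_outer_unit_normal \<Omega> x (\<nu> x)" if "x \<in> frontier \<Omega>" for x using \<nu> that by blast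
      have f': "u x = f x" and g': "G x \<bullet> \<nu> x = g x" if "x \<in> \<Gamma>" for x using f g that by auto
      show "\<bar>u y\<bar> \<le> \<epsilon>" "norm (G y) \<le> \<epsilon>"
        unfolding \<epsilon>_def by (rule cauchy_data_bound[OF \<Gamma>(1) \<nu>' C1 f' g' y]; assumption)+
    qed
    then have \<epsilon>0: "\<epsilon> \<ge> 0" using \<Gamma>(2) by (metis abs_ge_zero all_not_in_conv order_trans)
    have clos: "closure \<Gamma> \<subseteq> closure \<Omega>"
      using \<Gamma>(1) openin_imp_subset by (intro closure_minimal) (fastforce simp: frontier_def)+
    have small: "\<bar>u p\<bar> \<le> \<epsilon>" "norm (G p) \<le> \<epsilon>" if "p \<in> closure \<Gamma>" for p
      using continuous_on_closure_norm_le[OF continuous_on_subset[OF cu clos], of \<epsilon> p]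
        continuous_on_closure_norm_le[OF continuous_on_subset[OF cG clos], of \<epsilon> p] data that by auto
    have est: "\<bar>u z\<bar> \<le> C * \<delta> powr \<tau> z" if "\<epsilon> \<le> \<delta>" "0 < \<delta>" "\<delta> < 1" "z \<in> \<Omega>" for \<delta> z
      unfolding C_def using small that(1)
      by (intro interior_estimate[OF open_domain R A(1) u C1 bound \<tau> that(2,3) _ _ that(4)])
         (auto intro: order_trans)
    consider "\<epsilon> \<ge> 1" | "0 < \<epsilon>" "\<epsilon> < 1" | "\<epsilon> = 0" using \<epsilon>0 by linarith
    then have "\<bar>u x\<bar> \<le> C * \<epsilon> powr \<tau> x"
    proof cases
      case 1
      have "\<tau> x \<ge> 0" using \<tau> x by (simp add: is_harmonic_measure_def)
      then have "1 \<le> \<epsilon> powr \<tau> x" using 1 by (simp add: ge_one_powr_ge_zero)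
      then have "C * 1 \<le> C * \<epsilon> powr \<tau> x" using C(1) by (intro mult_left_mono) auto
      moreover have "\<bar>u x\<bar> \<le> A" using bound(1) x closure_subset by blast
      ultimately show ?thesis using C(2) by simp
    next
      case 2
      then show ?thesis using est x by simp
    next
      case 3
      have "u z = 0" if z: "z \<in> \<Omega>" "\<tau> z > 0" for z
      proof -
        have "((\<lambda>\<delta>. C * \<delta> powr \<tau> z) \<longlongrightarrow> C * 0) (at_right 0)"
        proof (intro tendsto_mult_left)
          have "((\<lambda>\<delta>. \<delta> powr \<tau> z) \<longlongrightarrow> 0 powr \<tau> z) (at_right 0)"
            using z(2)
            by (intro tendsto_powr2 tendsto_ident_at tendsto_const)
               (simp_all add: eventually_at_filter)
          then show "((\<lambda>\<delta>. \<delta> powr \<tau> z) \<longlongrightarrow> 0) (at_right 0)" using z(2) by simp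
        qed
        moreover have "\<forall>\<^sub>F \<delta> in at_right 0. \<bar>u z\<bar> \<le> C * \<delta> powr \<tau> z"
          using eventually_at_right_real[of 0 1, OF zero_less_one]
          by eventually_elim (rule est; use 3 z in simp)
        ultimately have "\<bar>u z\<bar> \<le> C * 0"
          by (rule tendsto_lowerbound) simp
        then show ?thesis by simp
      qed
      then have "u x = 0" using zero_cauchy_data[OF assms(1) \<Gamma> C1 u \<tau> _ x] by blast
      then show ?thesis using C(1) by simp
    qed
    then show "\<bar>u x\<bar> \<le> C * (W1inf_norm \<Omega> \<Gamma> f + Linf_norm \<Omega> \<Gamma> g) powr \<tau> x"
      by (simp only: \<epsilon>_def)
  qed
qed

end
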